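(* Let $L$ be the lollipop graph (a circle with a closed interval attached at one point), regarded as a topological space, and let $C^2(L) = (L \times L) \setminus \{(x_1,x_2) \in L\times L \mid x_1 = x_2\}$ be the configuration space of two distinct robots moving on $L$ without collisions. Then the topological complexity of $C^2(L)$ is three: $TC(C^2(L)) = 3$.
   Context: Lollipop graph: the generalized lollipop graph $C_{n,g}$ is the connected graph on $n$ vertices of girth $g$ obtained by appending a single cycle of length $g$ to a pendant vertex of a path on $n-g$ vertices. The lollipop graph is $L = C_{2,1}$: it has two vertices $v_1, v_2$, one edge joining $v_1$ to $v_2$, and one loop based at $v_2$. As a topological space it is the geometric realization of this graph, i.e. the space obtained from the disjoint union of the interval $I=[0,1]$ and the circle $S^1$ by identifying one endpoint of $I$ with one point of $S^1$ (both endpoints of $I$ belong to $L$). Configuration space: for a space $\Gamma$, $C^2(\Gamma) = \Gamma\times\Gamma \setminus \Delta$ where $\Delta = \{(x_1,x_2)\in\Gamma^2 \mid x_1 = x_2\}$, with the subspace topology from the product $\Gamma\times\Gamma$ (the robots are distinguishable, so configurations are ordered pairs). Topological complexity: for a space $X$, let $PX$ be the space of all continuous paths $\alpha:[0,1]\to X$ (with the compact-open topology), and let $ev: PX \to X\times X$, $ev(\alpha) = (\alpha(0),\alpha(1))$. For a connected space $X$, $TC(X)$ is the minimum integer $k$ such that $X\times X$ can be covered by $k$ open subsets $U_1,\dots,U_k$ such that for each $i = 1,\dots,k$ there is a continuous map $s_i : U_i \to PX$ with $ev\circ s_i$ equal to the inclusion $U_i \hookrightarrow X\times X$; if no such $k$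 exists, $TC(X)=\infty$. (This is the non-reduced convention: a contractible space has $TC = 1$.) *)

theory Defs
  imports "HOL-Analysis.Analysis" "HOL-Library.Extended_Nat"
begin

section \<open>The lollipop graph as a topological space\<close>

definition quotient_topology :: "'a topology \<Rightarrow> ('a \<Rightarrow> 'b) \<Rightarrow> 'b topology" where
  "quotient_topology X q =
     topology (\<lambda>U. U \<subseteq> q ` topspace X \<and> openin X {x \<in> topspace X. q x \<in> U})"

lemma openin_quotient_topology:
  "openin (quotient_topology X q) U \<longleftrightarrow>
     U \<subseteq> q ` topspace X \<and> openin X {x \<in> topspace X. q x \<in> U}"
proof -
  have 1: "{x \<in> topspace X. q x \<in> S \<inter> T} = {x \<in> topspace X. q x \<in> S} \<inter> {x \<in> topspace X. q x \<in> T}"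
    for S T by auto
  have 2: "{x \<in> topspace X. q x \<in> \<Union>\<K>} = (\<Union>K\<in>\<K>. {x \<in> topspace X. q x \<in> K})" for \<K>
    by auto
  have "istopology (\<lambda>U. U \<subseteq> q ` topspace X \<and> openin X {x \<in> topspace X. q x \<in> U})"
    unfolding istopology_def 1 2 by (intro conjI allI impI openin_Int openin_Union) auto
  then show ?thesis
    by (simp add: quotient_topology_def)
qed

lemma topspace_quotient_topology [simp]:
  "topspace (quotient_topology X q) = q ` topspace X"
proof
  show "topspace (quotient_topology X q) \<subseteq> q ` topspace X"
    using openin_topspace[of "quotient_topology X q"] by (simp only: openin_quotient_topology)
  have "{x \<in> topspace X. q x \<in> q ` topspace X} = topspace X"
    by auto
  then have "openin (quotient_topology X q) (q ` topspace X)"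
    by (simp add: openin_quotient_topology)
  then show "q ` topspace X \<subseteq> topspace (quotient_topology X q)"
    by (rule openin_subset)
qed

lemma quotient_map_quotient_topology: "quotient_map X (quotient_topology X q) q"
  by (simp add: quotient_map_def openin_quotient_topology)

text \<open>Sends each point to its class under the equivalence relation whose only possibly
  non-trivial class is \<open>A\<close>, so that \<open>quotient_topology X (identify A)\<close> is \<open>X / A\<close>.\<close>

definition identify :: "'a set \<Rightarrow> 'a \<Rightarrow> 'a set" where
  "identify A x = (if x \<in> A then A else {x})"

datatype lollipop_part = Stick | Loop

text \<open>Both parts live in the complex plane because \<^const>\<open>sum_topology\<close> needs summands of
  one type: the unit interval is the segment from \<open>0\<close> to \<open>1\<close> and the circle is the unit circle.
  The endpoint \<open>1\<close> of the segment is glued to the point \<open>1\<close> of the circle.\<close>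

fun lollipop_piece :: "lollipop_part \<Rightarrow> complex topology" where
  "lollipop_piece Stick = top_of_set (closed_segment 0 1)"
| "lollipop_piece Loop = top_of_set (sphere 0 1)"

definition lollipop :: "(lollipop_part \<times> complex) set topology" where
  "lollipop =
     quotient_topology (sum_topology lollipop_piece UNIV) (identify {(Stick, 1), (Loop, 1)})"


section \<open>Configurations of two distinguishable robots\<close>

definition config2 :: "'a topology \<Rightarrow> ('a \<times> 'a) topology" where
  "config2 X = subtopology (prod_topology X X) {(x, y). x \<noteq> y}"


section \<open>Topological complexity\<close>

text \<open>Continuous maps are represented by functions that are \<^const>\<open>undefined\<close> outside
  \<open>topspace X\<close>, so that equality of points is equality of maps on \<open>topspace X\<close>.\<close>

definition compact_open_topology :: "'a topology \<Rightarrow> 'b topology \<Rightarrow> ('a \<Rightarrow> 'b) topology" where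
  "compact_open_topology X Y =
     topology_generated_by
       {{f \<in> extensional (topspace X). continuous_map X Y f \<and> f ` K \<subseteq> U} | K U.
          compactin X K \<and> openin Y U}"

lemma topspace_compact_open_topology:
  "topspace (compact_open_topology X Y) = {f \<in> extensional (topspace X). continuous_map X Y f}"
proof -
  let ?C = "{f \<in> extensional (topspace X). continuous_map X Y f}"
  let ?S = "{{f \<in> extensional (topspace X). continuous_map X Y f \<and> f ` K \<subseteq> U} | K U.
          compactin X K \<and> openin Y U}"
  have "compactin X {}" "openin Y {}" "?C = {f \<in> extensional (topspace X). continuous_map X Y f \<and> f ` {} \<subseteq> {}}"
    by simp_all
  then have "?C \<in> ?S"
    by (intro CollectI exI conjI)
  moreover have "T \<subseteq> ?C" if "T \<in> ?S" for T
    using that by (elim CollectE exE conjE) (simp only: Collect_mono_iff, simp)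
  ultimately have "\<Union>?S = ?C"
    by (intro equalityI Union_least Union_upper)
  then show ?thesis
    by (simp only: compact_open_topology_def topology_generated_by_topspace)
qed

definition path_space :: "'a topology \<Rightarrow> (real \<Rightarrow> 'a) topology" where
  "path_space X = compact_open_topology (top_of_set {0..1}) X"

lemma topspace_path_space:
  "topspace (path_space X) = {\<alpha> \<in> extensional {0..1}. pathin X \<alpha>}"
  by (simp add: path_space_def topspace_compact_open_topology pathin_def)

definition path_ev :: "(real \<Rightarrow> 'a) \<Rightarrow> 'a \<times> 'a" where
  "path_ev \<alpha> = (\<alpha> 0, \<alpha> 1)"

definition motion_planner :: "'a topology \<Rightarrow> ('a \<times> 'a) set \<Rightarrow> ('a \<times> 'a \<Rightarrow> real \<Rightarrow> 'a) \<Rightarrow> bool" where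
  "motion_planner X U s \<longleftrightarrow>
     continuous_map (subtopology (prod_topology X X) U) (path_space X) s \<and>
     (\<forall>p\<in>U. path_ev (s p) = p)"

text \<open>Not reduced: a contractible space has topological complexity \<open>1\<close>. The infimum of the
  empty set in \<^typ>\<open>enat\<close> is \<open>\<infinity>\<close>.\<close>

definition topological_complexity :: "'a topology \<Rightarrow> enat" where
  "topological_complexity X =
     Inf {enat k | k. \<exists>U :: nat \<Rightarrow> ('a \<times> 'a) set.
            (\<forall>i<k. openin (prod_topology X X) (U i) \<and> (\<exists>s. motion_planner X (U i) s)) \<and>
            (\<Union>i<k. U i) = topspace (prod_topology X X)}"

end

theory Submission
  imports Defs
begin

text \<open>
  Realise the lollipop as the unit circle with the segment from \<open>1\<close> to \<open>2\<close> in the complex plane.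

  Lower bound: let one robot wait at \<open>2\<close> while the other runs around the circle. This gives two loops, hence a map
  \<open>(z, w) \<mapsto> ((z, 2), (2, w))\<close> of the torus into pairs of configurations. A motion planner on an
  open set moves the first robot from \<open>z\<close> to \<open>2\<close> in the punctured plane and the second from \<open>2\<close> to
  \<open>w\<close>; lifting along the exponential map yields continuous logarithms of both \<open>z\<close> and \<open>w\<close> on
  the corresponding part of the torus. So two planners would give an open cover of the torus with a
  logarithm of \<open>z\<close> on one set and of \<open>w\<close> on the other, which is impossible.

  Upper bound: the configuration space is covered by two open sets, each contractible in it.
  One consists of the configurations in which the robots have different distances to the junction:
  there the nearer robot moves to the junction, which leaves contractible pieces. The other consists of the
  configurations with no robot at the junction and not both robots on the stick: it is a disjoint union
  of four sets that are convex in arc coordinates.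
\<close>

section \<open>Motion planners as maps of two variables\<close>

text \<open>This is the tube lemma: a point \<open>z\<close> leaves the preimage of a subbasic set
  iff some \<open>x\<close> in the compact set \<open>K\<close> has \<open>F (z, x)\<close> outside
  \<open>U\<close>. These \<open>z\<close> form the projection of a closed set along
  \<open>K\<close>, and projection along a compact factor is a closed map.\<close>

lemma continuous_map_curry_compact_open:
  assumes F: "continuous_map (prod_topology Z X) Y F"
  shows "continuous_map Z (compact_open_topology X Y) (\<lambda>z. restrict (\<lambda>x. F (z, x)) (topspace X))"
    (is "continuous_map _ _ ?g")
proof -
  have slice: "continuous_map X Y (?g z)" if "z \<in> topspace Z" for z
  proof -
    have "continuous_map X (prod_topology Z X) (\<lambda>x. (z, x))"
      using that by (intro continuous_map_pairedI) auto
    then have "continuous_map X Y (\<lambda>x. F (z, x))"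
      using continuous_map_compose[OF _ F] by (simp add: o_def)
    then show ?thesis
      by (rule continuous_map_eq) simp
  qed
  have "openin Z (?g -` W \<inter> topspace Z)"
    if "compactin X K" "openin Y U"
      and W: "W = {f \<in> extensional (topspace X). continuous_map X Y f \<and> f ` K \<subseteq> U}" for W K U
  proof -
    let ?K = "subtopology X K"
    have KX: "K \<subseteq> topspace X"
      using \<open>compactin X K\<close> by (rule compactin_subset_topspace)
    have "continuous_map (prod_topology Z ?K) Y F"
      using F by (simp add: prod_topology_subtopology continuous_map_from_subtopology)
    then have "closedin (prod_topology Z ?K)
        {p \<in> topspace (prod_topology Z ?K). F p \<in> topspace Y - U}" (is "closedin _ ?C")
      by (rule closedin_continuous_map_preimage) (use \<open>openin Y U\<close> in \<open>simp add: closedin_diff\<close>)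
    moreover have "closed_map (prod_topology Z ?K) Z fst"
      using \<open>compactin X K\<close>
      by (intro Abstract_Topological_Spaces.closed_map_fst) (simp add: compact_space_subtopology)
    ultimately have "closedin Z (fst ` ?C)"
      unfolding closed_map_def by blast
    moreover have "?g -` W \<inter> topspace Z = topspace Z - fst ` ?C"
    proof -
      have "z \<in> fst ` ?C \<longleftrightarrow> (\<exists>x\<in>K. F (z, x) \<notin> U)" if z: "z \<in> topspace Z" for z
      proof
        assume "\<exists>x\<in>K. F (z, x) \<notin> U"
        then obtain x where x: "x \<in> K" "F (z, x) \<notin> U"
          by blast
        have "F (z, x) \<in> topspace Y"
          using continuous_map_image_subset_topspace[OF F] z x KX by auto
        then show "z \<in> fst ` ?C"
          using z x KX by (intro image_eqI[of _ _ "(z, x)"]) auto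
      qed auto
      moreover have "?g z \<in> W \<longleftrightarrow> (\<forall>x\<in>K. F (z, x) \<in> U)" if z: "z \<in> topspace Z" for z
        using slice[OF z] KX by (auto simp: W subset_iff)
      ultimately show ?thesis
        by auto
    qed
    ultimately show ?thesis
      by (simp add: openin_diff)
  qed
  moreover have "?g ` topspace Z \<subseteq> topspace (compact_open_topology X Y)"
    using slice by (auto simp: topspace_compact_open_topology)
  ultimately show ?thesis
    unfolding compact_open_topology_def topology_generated_by_topspace
    by (intro continuous_on_generated_topo) (elim CollectE exE conjE, simp only:, assumption)
qed

text \<open>Local compactness and regularity give a compact neighbourhood \<open>K\<close> of
  \<open>x\<close> that \<open>g z\<close> still maps into \<open>U\<close>. The maps sending
  \<open>K\<close> into \<open>U\<close> form a subbasic open set, so nearby \<open>z\<close> do the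
  same on all of \<open>K\<close>.\<close>

lemma continuous_map_uncurry_compact_open:
  assumes g: "continuous_map Z (compact_open_topology X Y) g"
    and X: "locally_compact_space X" "regular_space X"
  shows "continuous_map (prod_topology Z X) Y (\<lambda>(z, x). g z x)"
proof -
  have slice: "continuous_map X Y (g z)" if "z \<in> topspace Z" for z
    using continuous_map_image_subset_topspace[OF g] that
    by (auto simp: topspace_compact_open_topology)
  have "openin (prod_topology Z X) {p \<in> topspace (prod_topology Z X). (\<lambda>(z, x). g z x) p \<in> U}"
    (is "openin _ ?P") if U: "openin Y U" for U
    unfolding openin_prod_topology_alt
  proof (intro allI impI)
    fix z x assume zx: "(z, x) \<in> ?P"
    have "openin X {x \<in> topspace X. g z x \<in> U}"
      using slice[of z] zx U by (intro openin_continuous_map_preimage) auto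
    moreover have "neighbourhood_base_of (\<lambda>C. compactin X C \<and> closedin X C) X"
      using X locally_compact_regular_space_neighbourhood_base by blast
    ultimately obtain V K where VK: "openin X V" "compactin X K" "x \<in> V" "V \<subseteq> K"
        "K \<subseteq> {x \<in> topspace X. g z x \<in> U}"
      using zx unfolding neighbourhood_base_of
      by (auto dest!: spec[of _ "{x \<in> topspace X. g z x \<in> U}"] spec[of _ x])
    let ?W = "{f \<in> extensional (topspace X). continuous_map X Y f \<and> f ` K \<subseteq> U}"
    have "openin (compact_open_topology X Y) ?W"
      unfolding compact_open_topology_def
      by (rule topology_generated_by_Basis) (intro CollectI exI[of _ K] exI[of _ U] conjI refl VK U)
    then have "openin Z {z \<in> topspace Z. g z \<in> ?W}"
      using g by (rule openin_continuous_map_preimage[rotated])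
    moreover have "z \<in> {z \<in> topspace Z. g z \<in> ?W}"
      using zx VK continuous_map_image_subset_topspace[OF g]
      by (auto simp: topspace_compact_open_topology)
    moreover have "{z \<in> topspace Z. g z \<in> ?W} \<times> V \<subseteq> ?P"
      using VK by auto
    ultimately show "\<exists>A B. openin Z A \<and> openin X B \<and> z \<in> A \<and> x \<in> B \<and> A \<times> B \<subseteq> ?P"
      using VK by blast
  qed
  moreover have "(\<lambda>(z, x). g z x) \<in> topspace (prod_topology Z X) \<rightarrow> topspace Y"
    using slice by (auto simp: continuous_map_def)
  ultimately show ?thesis
    by (simp add: continuous_map_def)
qed

text \<open>The exponential law for the unit interval. It lets planners be built and analysed below
  as homotopies, without returning to the compact-open topology.\<close>

lemma ex_motion_planner_iff:
  fixes X :: "'a topology"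
  assumes U: "U \<subseteq> topspace (prod_topology X X)"
  shows "(\<exists>s. motion_planner X U s) \<longleftrightarrow>
    (\<exists>F. continuous_map
          (prod_topology (subtopology (prod_topology X X) U) (top_of_set {0..1::real})) X F \<and>
        (\<forall>p\<in>U. F (p, 0) = fst p \<and> F (p, 1) = snd p))"
proof
  let ?I = "top_of_set {0..1::real}"
  have I: "locally_compact_space ?I" "regular_space ?I"
    by (simp_all add: compact_imp_locally_compact_space compact_space_subtopology
        regular_space_subtopology regular_space_euclidean)
  assume "\<exists>s. motion_planner X U s"
  then obtain s where s: "continuous_map (subtopology (prod_topology X X) U) (path_space X) s"
    and ev: "\<forall>p\<in>U. path_ev (s p) = p"
    by (auto simp: motion_planner_def)
  have "continuous_map (prod_topology (subtopology (prod_topology X X) U) ?I) X (\<lambda>(p, t). s p t)"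
    using s I unfolding path_space_def by (rule continuous_map_uncurry_compact_open)
  moreover have "\<forall>p\<in>U. s p 0 = fst p \<and> s p 1 = snd p"
    using ev by (metis fst_conv snd_conv path_ev_def)
  ultimately show "\<exists>F. continuous_map
          (prod_topology (subtopology (prod_topology X X) U) (top_of_set {0..1::real})) X F \<and>
        (\<forall>p\<in>U. F (p, 0) = fst p \<and> F (p, 1) = snd p)"
    by (intro exI[of _ "\<lambda>(p, t). s p t"]) simp
next
  assume "\<exists>F. continuous_map
          (prod_topology (subtopology (prod_topology X X) U) (top_of_set {0..1::real})) X F \<and>
        (\<forall>p\<in>U. F (p, 0) = fst p \<and> F (p, 1) = snd p)"
  then obtain F where F: "continuous_map
          (prod_topology (subtopology (prod_topology X X) U) (top_of_set {0..1::real})) X F"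
    and ends: "\<forall>p\<in>U. F (p, 0) = fst p \<and> F (p, 1) = snd p"
    by blast
  have "motion_planner X U (\<lambda>p. restrict (\<lambda>t. F (p, t)) {0..1})"
    using continuous_map_curry_compact_open[OF F] ends
    by (simp add: motion_planner_def path_space_def path_ev_def)
  then show "\<exists>s. motion_planner X U s"
    by blast
qed

section \<open>Homeomorphism invariance of topological complexity\<close>

lemma motion_planner_homeomorphic_image:
  assumes fg: "homeomorphic_maps X Y f g"
    and U: "openin (prod_topology X X) U" and s: "motion_planner X U s"
  shows "openin (prod_topology Y Y) (map_prod f f ` U)"
    and "\<exists>s. motion_planner Y (map_prod f f ` U) s"
proof -
  let ?U = "map_prod f f ` U"
  have f: "continuous_map X Y f" and g: "continuous_map Y X g"
    and gf: "\<And>x. x \<in> topspace X \<Longrightarrow> g (f x) = x" and fgy: "\<And>y. y \<in> topspace Y \<Longrightarrow> f (g y) = y"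
    using fg by (auto simp: homeomorphic_maps_def)
  have UX: "U \<subseteq> topspace X \<times> topspace X"
    using openin_subset[OF U] by simp
  have gg: "continuous_map (prod_topology Y Y) (prod_topology X X) (\<lambda>p. (g (fst p), g (snd p)))"
    using continuous_map_compose[OF continuous_map_fst g] continuous_map_compose[OF continuous_map_snd g]
    by (intro continuous_map_pairedI) (simp_all add: o_def)
  \<comment> \<open>Seen as a preimage under the inverse map, the image of \<open>U\<close> is
    visibly open, and the planner can be conjugated by \<open>f\<close> and
    \<open>g\<close>.\<close>
  have eq: "?U = {p \<in> topspace (prod_topology Y Y). (g (fst p), g (snd p)) \<in> U}"
  proof (intro equalityI subsetI)
    fix p assume "p \<in> ?U"
    then show "p \<in> {p \<in> topspace (prod_topology Y Y). (g (fst p), g (snd p)) \<in> U}"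
      using UX gf f by (force simp: continuous_map_def)
  next
    fix p assume "p \<in> {p \<in> topspace (prod_topology Y Y). (g (fst p), g (snd p)) \<in> U}"
    then show "p \<in> ?U"
      using fgy by (intro image_eqI[where x = "(g (fst p), g (snd p))"]) (auto simp: prod_eq_iff)
  qed
  show "openin (prod_topology Y Y) ?U"
    unfolding eq by (rule openin_continuous_map_preimage[OF gg U])
  obtain F where F: "continuous_map
        (prod_topology (subtopology (prod_topology X X) U) (top_of_set {0..1::real})) X F"
    and ends: "\<And>p. p \<in> U \<Longrightarrow> F (p, 0) = fst p \<and> F (p, 1) = snd p"
    using ex_motion_planner_iff[OF openin_subset[OF U]] s by blast
  let ?Z = "prod_topology (subtopology (prod_topology Y Y) ?U) (top_of_set {0..1::real})"
  have "continuous_map (subtopology (prod_topology Y Y) ?U) (subtopology (prod_topology X X) U)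
      (\<lambda>p. (g (fst p), g (snd p)))"
    using gg by (auto simp: continuous_map_in_subtopology continuous_map_from_subtopology eq)
  then have "continuous_map ?Z (prod_topology (subtopology (prod_topology X X) U) (top_of_set {0..1::real}))
      (\<lambda>z. ((g (fst (fst z)), g (snd (fst z))), snd z))"
    using continuous_map_compose[OF continuous_map_fst] 
    by (intro continuous_map_pairedI continuous_map_snd) (fastforce simp: o_def)
  then have "continuous_map ?Z Y (f \<circ> (F \<circ> (\<lambda>z. ((g (fst (fst z)), g (snd (fst z))), snd z))))"
    by (intro continuous_map_compose[OF _ f] continuous_map_compose[OF _ F])
  moreover have "\<forall>p\<in>?U. (f \<circ> (F \<circ> (\<lambda>z. ((g (fst (fst z)), g (snd (fst z))), snd z)))) (p, 0) = fst p \<and>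
      (f \<circ> (F \<circ> (\<lambda>z. ((g (fst (fst z)), g (snd (fst z))), snd z)))) (p, 1) = snd p"
    using ends fgy by (auto simp: eq)
  ultimately show "\<exists>s. motion_planner Y ?U s"
    using ex_motion_planner_iff[of ?U Y] eq by blast
qed

lemma topological_complexity_homeomorphic_le:
  fixes X :: "'a topology" and Y :: "'b topology"
  assumes "X homeomorphic_space Y"
  shows "topological_complexity Y \<le> topological_complexity X"
  unfolding topological_complexity_def
proof (rule Inf_superset_mono, safe)
  fix k :: nat and U :: "nat \<Rightarrow> ('a \<times> 'a) set"
  assume U: "\<forall>i<k. openin (prod_topology X X) (U i) \<and> (\<exists>s. motion_planner X (U i) s)"
    and cov: "(\<Union>i<k. U i) = topspace (prod_topology X X)"
  obtain f g where fg: "homeomorphic_maps X Y f g"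
    using assms by (auto simp: homeomorphic_space_def)
  then have "f ` topspace X = topspace Y"
    using homeomorphic_imp_surjective_map homeomorphic_maps_imp_map by blast
  then have "map_prod f f ` topspace (prod_topology X X) = topspace (prod_topology Y Y)"
    by (auto simp: map_prod_surj_on)
  then have "(\<Union>i<k. map_prod f f ` U i) = topspace (prod_topology Y Y)"
    using cov by (metis image_UN)
  then show "\<exists>k'. enat k = enat k' \<and> (\<exists>V. (\<forall>i<k'. openin (prod_topology Y Y) (V i) \<and>
      (\<exists>s. motion_planner Y (V i) s)) \<and> (\<Union>i<k'. V i) = topspace (prod_topology Y Y))"
    using U by (intro exI[of _ k] conjI refl exI[of _ "\<lambda>i. map_prod f f ` U i"])
      (auto intro: motion_planner_homeomorphic_image[OF fg])
qed

lemma topological_complexity_homeomorphic: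
  assumes "X homeomorphic_space Y"
  shows "topological_complexity X = topological_complexity Y"
  using assms homeomorphic_space_sym topological_complexity_homeomorphic_le antisym by metis

section \<open>Logarithms on the torus and the lower bound\<close>

text \<open>Brouwer's theorem is applied to \<open>p + (f p, g p)\<close> clamped back to the
  square. At a fixed point a nonzero \<open>f p\<close> or \<open>g p\<close> could only be absorbed
  by the clamp, that is, it would point outward at a side; the sign conditions make it point inward
  there.\<close>

lemma poincare_miranda_2d:
  fixes f g :: "real \<times> real \<Rightarrow> real" and M :: real
  assumes M: "0 \<le> M"
    and cf: "continuous_on ({-M..M} \<times> {-M..M}) f" and cg: "continuous_on ({-M..M} \<times> {-M..M}) g"
    and left: "\<And>y. y \<in> {-M..M} \<Longrightarrow> f (-M, y) > 0" and right: "\<And>y. y \<in> {-M..M} \<Longrightarrow> f (M, y) < 0"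
    and bottom: "\<And>x. x \<in> {-M..M} \<Longrightarrow> g (x, -M) > 0" and top: "\<And>x. x \<in> {-M..M} \<Longrightarrow> g (x, M) < 0"
  shows "\<exists>p \<in> {-M..M} \<times> {-M..M}. f p = 0 \<and> g p = 0"
proof -
  let ?Q = "{-M..M} \<times> {-M..M}"
  define c where "c t = max (-M) (min M t)" for t :: real
  define F where "F p = (c (fst p + f p), c (snd p + g p))" for p
  have "continuous_on ?Q F"
    unfolding F_def c_def by (intro continuous_intros cf cg)
  moreover have "F \<in> ?Q \<rightarrow> ?Q"
    using M by (auto simp: F_def c_def)
  moreover have "compact ?Q" "convex ?Q" "?Q \<noteq> {}"
    using M by (auto intro: compact_Times convex_Times)
  ultimately obtain p where p: "p \<in> ?Q" "F p = p"
    using brouwer by metis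
  obtain x y where xy: "p = (x, y)" "x \<in> {-M..M}" "y \<in> {-M..M}"
    using p(1) by auto
  have "c (x + f p) = x" "c (y + g p) = y"
    using p(2) xy(1) by (auto simp: F_def)
  then have "f p = 0" "g p = 0"
    using left[OF xy(3)] right[OF xy(3)] bottom[OF xy(2)] top[OF xy(2)] xy
    by (auto simp: c_def max_def min_def split: if_splits)
  then show ?thesis
    using p by blast
qed

text \<open>A continuous logarithm of a coordinate on an open part of the torus assigns integers to the points
  of its preimage in the plane. On a large square this separates the two opposite sides, and
  the Poincare--Miranda theorem forbids separating both pairs of sides at once.\<close>

lemma torus_separation:
  fixes A :: "(real \<times> real) set" and m :: "real \<times> real \<Rightarrow> real" and \<pi> :: "real \<times> real \<Rightarrow> real"
  assumes Q: "Q = {-M..M} \<times> {-M..M}" and M: "0 < M" and A: "closed A" and cm: "continuous_on A m"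
    and int: "\<And>p. p \<in> A \<Longrightarrow> m p / (2 * pi) \<in> \<int>"
    and pr: "continuous_on UNIV \<pi>"
    and bound: "\<And>p. p \<in> A \<inter> Q \<Longrightarrow> \<bar>m p - \<pi> p\<bar> < M"
  obtains h :: "real \<times> real \<Rightarrow> real" where "continuous_on Q h" "\<And>p. p \<in> A \<inter> Q \<Longrightarrow> h p \<noteq> 0"
    "\<And>p. p \<in> Q \<Longrightarrow> \<pi> p = -M \<Longrightarrow> h p > 0" "\<And>p. p \<in> Q \<Longrightarrow> \<pi> p = M \<Longrightarrow> h p < 0"
proof -
  \<comment> \<open>The values of \<open>m\<close> on \<open>A\<close> are multiples of
    \<open>2 * pi\<close>, so cutting between \<open>0\<close> and \<open>2 * pi\<close> loses no
    point of \<open>A \<inter> Q\<close>. By \<open>bound\<close>, \<open>m\<close> is negative on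
    the side \<open>-M\<close> and positive on the side \<open>M\<close>, which keeps
    \<open>L\<close> and \<open>R\<close> disjoint.\<close>
  define L where "L = {p \<in> A \<inter> Q. m p \<le> 0} \<union> {p \<in> Q. \<pi> p = -M}"
  define R where "R = {p \<in> A \<inter> Q. m p \<ge> 2 * pi} \<union> {p \<in> Q. \<pi> p = M}"
  have clQ: "closed Q"
    unfolding Q by (intro closed_Times) auto
  have "closed {p \<in> A \<inter> Q. m p \<in> I}" if "closed I" for I
  proof -
    have "closed (A \<inter> Q \<inter> m -` I)"
      using A clQ that by (intro continuous_closed_preimage continuous_on_subset[OF cm]) auto
    then show ?thesis
      by (simp add: Int_def vimage_def conj_assoc)
  qed
  from this[of "{..0}"] this[of "{2 * pi..}"]
  have "closed {p \<in> A \<inter> Q. m p \<le> 0}" "closed {p \<in> A \<inter> Q. m p \<ge> 2 * pi}"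
    by simp_all
  moreover have "closed {p \<in> Q. \<pi> p = c}" for c
  proof -
    have "closed (Q \<inter> \<pi> -` {c})"
      using pr clQ by (intro closed_Int continuous_closed_vimage)
        (auto simp: continuous_on_eq_continuous_at)
    then show ?thesis
      by (simp add: vimage_def Int_def)
  qed
  ultimately have cl: "closed L" "closed R"
    by (auto simp: L_def R_def)
  have disj: "L \<inter> R = {}"
  proof (rule ccontr)
    assume "L \<inter> R \<noteq> {}"
    then obtain p where "p \<in> L" "p \<in> R"
      by blast
    then show False
      using bound[of p] M pi_ge_two by (auto simp: L_def R_def)
  qed
  have AQ: "A \<inter> Q \<subseteq> L \<union> R"
  proof
    fix p assume p: "p \<in> A \<inter> Q"
    then obtain k :: int where "m p = k * (2 * pi)"
      using int[of p] by (auto simp: field_simps elim!: Ints_cases)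
    then show "p \<in> L \<union> R"
      using p pi_gt_zero by (cases "k \<le> 0") (auto simp: L_def R_def mult_nonpos_nonneg)
  qed
  \<comment> \<open>A Urysohn function equal to \<open>1\<close> on \<open>L\<close> and
    \<open>-1\<close> on \<open>R\<close> has the required signs, and it vanishes nowhere on
    \<open>A \<inter> Q\<close> because \<open>L\<close> and \<open>R\<close> cover that
    set.\<close>
  obtain h :: "real \<times> real \<Rightarrow> real" where h: "continuous_on UNIV h"
      "\<And>x. h x = 1 \<longleftrightarrow> x \<in> L" "\<And>x. h x = -1 \<longleftrightarrow> x \<in> R"
    by (rule Urysohn_strong[OF cl disj, of 1 "-1::real"]) (simp, blast)
  show thesis
  proof
    show "continuous_on Q h"
      using h(1) continuous_on_subset by blast
    show "h p \<noteq> 0" if "p \<in> A \<inter> Q" for p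
      using that AQ h(2)[of p] h(3)[of p] by force
    show "h p > 0" if "p \<in> Q" "\<pi> p = -M" for p
      using that h(2)[of p] by (auto simp: L_def)
    show "h p < 0" if "p \<in> Q" "\<pi> p = M" for p
      using that h(3)[of p] by (auto simp: R_def)
  qed
qed

text \<open>A Urysohn function for the two disjoint complements is cut at \<open>1/2\<close>. On the
  torus the closed pieces are compact, so the logarithms are bounded on them.\<close>

lemma closed_shrinking_2:
  fixes T :: "'a::euclidean_space set"
  assumes "openin (top_of_set T) U" "openin (top_of_set T) V" "U \<union> V = T"
  obtains A B where "closedin (top_of_set T) A" "closedin (top_of_set T) B" "A \<subseteq> U" "B \<subseteq> V" "A \<union> B = T"
proof -
  have "closedin (top_of_set T) (T - U)" "closedin (top_of_set T) (T - V)" "(T - U) \<inter> (T - V) = {}"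
    using assms by (auto intro: closedin_diff)
  then obtain f :: "'a \<Rightarrow> real" where f: "continuous_on T f"
      "\<And>x. x \<in> T \<Longrightarrow> f x = 0 \<longleftrightarrow> x \<in> T - U" "\<And>x. x \<in> T \<Longrightarrow> f x = 1 \<longleftrightarrow> x \<in> T - V"
    by (rule Urysohn_local_strong[of T "T - U" "T - V" 0 "1::real"]) (simp, blast)
  have "closedin (top_of_set T) (T \<inter> f -` {1/2..})" "closedin (top_of_set T) (T \<inter> f -` {..1/2})"
    using f(1) by (auto intro: continuous_closedin_preimage)
  moreover have "T \<inter> f -` {1/2..} \<subseteq> U" "T \<inter> f -` {..1/2} \<subseteq> V"
  proof -
    have "x \<in> U" if "x \<in> T" "1/2 \<le> f x" for x
      using f(2)[of x] that by (cases "x \<in> U") auto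
    moreover have "x \<in> V" if "x \<in> T" "f x \<le> 1/2" for x
      using f(3)[of x] that by (cases "x \<in> V") auto
    ultimately show "T \<inter> f -` {1/2..} \<subseteq> U" "T \<inter> f -` {..1/2} \<subseteq> V"
      by auto
  qed
  moreover have "(T \<inter> f -` {1/2..}) \<union> (T \<inter> f -` {..1/2}) = T"
    by (auto simp: not_le)
  ultimately show thesis
    by (rule that)
qed

text \<open>Pull everything back to the plane by \<open>e\<close>. On the preimage of
  \<open>A\<close> the difference between the first coordinate and the imaginary part of the
  logarithm is a multiple of \<open>2 * pi\<close>, and it stays within \<open>M\<close> of the
  coordinate; likewise for \<open>B\<close> and the second coordinate. The separating functions
  \<open>h\<close> and \<open>k\<close> have a common zero by Poincare--Miranda, which lies over
  neither \<open>A\<close> nor \<open>B\<close>, although these cover the torus.\<close>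

lemma torus_no_two_logarithms:
  fixes U V :: "(complex \<times> complex) set"
  defines "T \<equiv> sphere 0 1 \<times> sphere 0 1"
  assumes U: "openin (top_of_set T) U" and V: "openin (top_of_set T) V" and UV: "U \<union> V = T"
    and u: "continuous_on U u" "\<And>p. p \<in> U \<Longrightarrow> exp (u p) = fst p"
    and v: "continuous_on V v" "\<And>p. p \<in> V \<Longrightarrow> exp (v p) = snd p"
  shows False
proof -
  have T: "compact T"
    unfolding T_def by (intro compact_Times compact_sphere)
  obtain A B where AB: "closedin (top_of_set T) A" "closedin (top_of_set T) B" "A \<subseteq> U" "B \<subseteq> V" "A \<union> B = T"
    using closed_shrinking_2[OF U V UV] by blast
  have cA: "compact A" and cB: "compact B"
    using AB T closedin_compact by auto
  have bd: "\<exists>C. \<forall>p\<in>K. \<bar>Im (w p)\<bar> \<le> C" if "compact K" "continuous_on K w"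
    for K :: "(complex \<times> complex) set" and w
  proof -
    have "bounded ((\<lambda>p. Im (w p)) ` K)"
      using that by (intro compact_imp_bounded compact_continuous_image continuous_intros)
    then show ?thesis
      by (auto simp: bounded_iff)
  qed
  obtain C where C: "\<And>p. p \<in> A \<Longrightarrow> \<bar>Im (u p)\<bar> \<le> C"
    using bd[OF cA continuous_on_subset[OF u(1) AB(3)]] by blast
  obtain D where D: "\<And>p. p \<in> B \<Longrightarrow> \<bar>Im (v p)\<bar> \<le> D"
    using bd[OF cB continuous_on_subset[OF v(1) AB(4)]] by blast
  \<comment> \<open>Strictly above both bounds and positive, as \<open>torus_separation\<close>
    requires for the half-side of the square.\<close>
  define M where "M = max 0 (max C D) + 1"
  define Q where "Q = {-M..M} \<times> {-M..M}"
  define e where "e p = (cis (fst p), cis (snd p))" for p :: "real \<times> real"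
  have e: "continuous_on UNIV e" "\<And>p. e p \<in> T"
    by (auto simp: e_def[abs_def] T_def intro!: continuous_intros)
  have cl: "closed (e -` K)" if "compact K" for K
    using that e(1) by (intro continuous_closed_vimage compact_imp_closed)
      (auto simp: continuous_on_eq_continuous_at)
  have im: "(x - Im z) / (2 * pi) \<in> \<int>" if "exp z = cis x" for x z
  proof -
    have "exp z = exp (\<i> * x)"
      using that by (simp add: cis_conv_exp)
    then obtain n :: int where "z = \<i> * x + (of_int (2 * n) * pi) * \<i>"
      unfolding exp_eq by blast
    then have "x - Im z = of_int (- n) * (2 * pi)"
      by simp
    then show ?thesis
      by (simp del: of_int_minus)
  qed
  have M: "0 < M" "C < M" "D < M"
    by (auto simp: M_def)
  obtain h where h: "continuous_on Q h" "\<And>p. p \<in> e -` A \<inter> Q \<Longrightarrow> h p \<noteq> (0::real)"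
    "\<And>p. p \<in> Q \<Longrightarrow> fst p = -M \<Longrightarrow> h p > 0" "\<And>p. p \<in> Q \<Longrightarrow> fst p = M \<Longrightarrow> h p < 0"
  proof (rule torus_separation[OF Q_def M(1) cl[OF cA], of "\<lambda>p. fst p - Im (u (e p))" fst])
    show "continuous_on (e -` A) (\<lambda>p. fst p - Im (u (e p)))"
      using AB by (intro continuous_intros continuous_on_compose2[OF u(1)]
          continuous_on_subset[OF e(1)]) auto
    show "(fst p - Im (u (e p))) / (2 * pi) \<in> \<int>" if "p \<in> e -` A" for p
      using that AB u(2)[of "e p"] by (intro im) (auto simp: e_def)
    show "\<bar>fst p - Im (u (e p)) - fst p\<bar> < M" if "p \<in> e -` A \<inter> Q" for p
      using that C[of "e p"] M by auto
  qed (auto intro: continuous_intros)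
  obtain k where k: "continuous_on Q k" "\<And>p. p \<in> e -` B \<inter> Q \<Longrightarrow> k p \<noteq> (0::real)"
    "\<And>p. p \<in> Q \<Longrightarrow> snd p = -M \<Longrightarrow> k p > 0" "\<And>p. p \<in> Q \<Longrightarrow> snd p = M \<Longrightarrow> k p < 0"
  proof (rule torus_separation[OF Q_def M(1) cl[OF cB], of "\<lambda>p. snd p - Im (v (e p))" snd])
    show "continuous_on (e -` B) (\<lambda>p. snd p - Im (v (e p)))"
      using AB by (intro continuous_intros continuous_on_compose2[OF v(1)]
          continuous_on_subset[OF e(1)]) auto
    show "(snd p - Im (v (e p))) / (2 * pi) \<in> \<int>" if "p \<in> e -` B" for p
      using that AB v(2)[of "e p"] by (intro im) (auto simp: e_def)
    show "\<bar>snd p - Im (v (e p)) - snd p\<bar> < M" if "p \<in> e -` B \<inter> Q" for p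
      using that D[of "e p"] M by auto
  qed (auto intro: continuous_intros)
  have "\<exists>p \<in> Q. h p = 0 \<and> k p = 0"
    unfolding Q_def using M h k by (intro poincare_miranda_2d) (auto simp: Q_def)
  then show False
    using h(2) k(2) AB(5) e(2) by blast
qed

lemma ex_motion_planner_top_of_set_iff:
  fixes S :: "'a::topological_space set"
  assumes U: "U \<subseteq> S \<times> S"
  shows "(\<exists>s. motion_planner (top_of_set S) U s) \<longleftrightarrow>
    (\<exists>F. continuous_on (U \<times> {0..1::real}) F \<and> F \<in> U \<times> {0..1} \<rightarrow> S \<and>
        (\<forall>p\<in>U. F (p, 0) = fst p \<and> F (p, 1) = snd p))"
proof -
  have "prod_topology (subtopology (prod_topology (top_of_set S) (top_of_set S)) U) (top_of_set {0..1::real})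
      = top_of_set (U \<times> {0..1})"
    using U by (simp add: subtopology_subtopology Int_absorb1)
  with ex_motion_planner_iff[of U "top_of_set S"] U show ?thesis
    by (simp add: conj_assoc)
qed

section \<open>Lower bound from two independent loops\<close>

lemma topological_complexity_config_ge:
  fixes G :: "complex set"
  assumes G: "sphere 0 1 \<subseteq> G" "2 \<in> G" "0 \<notin> G"
  defines "S \<equiv> {(x, y) \<in> G \<times> G. x \<noteq> y}"
  shows "3 \<le> topological_complexity (top_of_set S)"
proof -
  define T :: "(complex \<times> complex) set" where "T = sphere 0 1 \<times> sphere 0 1"
  define e :: "complex \<times> complex \<Rightarrow> (complex \<times> complex) \<times> (complex \<times> complex)"
    where "e q = ((fst q, 2), (2, snd q))" for q
  have contE: "continuous_on A e" for A
    unfolding e_def by (intro continuous_intros)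
  have eT: "e q \<in> S \<times> S" if "q \<in> T" for q
    using that G by (auto simp: e_def T_def S_def)
  have nz: "fst p \<noteq> 0" "snd p \<noteq> 0" if "p \<in> S" for p
    using that G by (auto simp: S_def)
  have planner: "\<exists>F. continuous_on ((T \<inter> e -` U) \<times> {0..1::real}) F \<and> F \<in> (T \<inter> e -` U) \<times> {0..1} \<rightarrow> S \<and>
      (\<forall>q\<in>T \<inter> e -` U. F (q, 0) = fst (e q) \<and> F (q, 1) = snd (e q))"
    if s: "motion_planner (top_of_set S) U s" and US: "U \<subseteq> S \<times> S" for U s
  proof -
    obtain F where F: "continuous_on (U \<times> {0..1::real}) F" "F \<in> U \<times> {0..1} \<rightarrow> S"
        "\<forall>p\<in>U. F (p, 0) = fst p \<and> F (p, 1) = snd p"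
      using ex_motion_planner_top_of_set_iff[OF US] s by blast
    have "continuous_on ((T \<inter> e -` U) \<times> {0..1::real}) (\<lambda>z. F (e (fst z), snd z))"
      by (intro continuous_on_compose2[OF F(1)] continuous_intros continuous_on_compose2[OF contE]) auto
    then show ?thesis
      using F by (intro exI[of _ "\<lambda>z. F (e (fst z), snd z)"]) auto
  qed
  have False if U: "openin (top_of_set (S \<times> S)) U" "motion_planner (top_of_set S) U s"
    and V: "openin (top_of_set (S \<times> S)) V" "motion_planner (top_of_set S) V s'"
    and UV: "U \<union> V = S \<times> S" for U V s s'
  proof -
    have op: "openin (top_of_set T) (T \<inter> e -` W)" if "openin (top_of_set (S \<times> S)) W" for W
      using continuous_openin_preimage[OF contE _ that, of T] eT by blast
    obtain F where F: "continuous_on ((T \<inter> e -` U) \<times> {0..1::real}) F" "F \<in> (T \<inter> e -` U) \<times> {0..1} \<rightarrow> S"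
        "\<And>q. q \<in> T \<inter> e -` U \<Longrightarrow> F (q, 0) = fst (e q) \<and> F (q, 1) = snd (e q)"
      using planner[OF U(2) openin_imp_subset[OF U(1)]] by blast
    obtain F' where F': "continuous_on ((T \<inter> e -` V) \<times> {0..1::real}) F'" "F' \<in> (T \<inter> e -` V) \<times> {0..1} \<rightarrow> S"
        "\<And>q. q \<in> T \<inter> e -` V \<Longrightarrow> F' (q, 0) = fst (e q) \<and> F' (q, 1) = snd (e q)"
      using planner[OF V(2) openin_imp_subset[OF V(1)]] by blast
    \<comment> \<open>The first robot travels from \<open>fst q\<close> to \<open>2\<close>. Its
      path is reversed in time so that the lift can start at the constant logarithm
      \<open>Ln 2\<close>; at time \<open>1\<close> the lift is then a logarithm of
      \<open>fst q\<close>.\<close>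
    obtain k where k: "continuous_on ((T \<inter> e -` U) \<times> {0..1::real}) k"
      "\<And>z. z \<in> (T \<inter> e -` U) \<times> {0..1} \<Longrightarrow> fst (F (fst z, 1 - snd z)) = exp (k z)"
    proof (rule covering_space_lift_homotopy_alt[OF covering_space_exp_punctured_plane,
        of "T \<inter> e -` U" "\<lambda>z. fst (F (fst z, 1 - snd z))" "\<lambda>_. Ln 2"])
      show "continuous_on ((T \<inter> e -` U) \<times> {0..1}) (\<lambda>z. fst (F (fst z, 1 - snd z)))"
        by (intro continuous_intros continuous_on_compose2[OF F(1)]) auto
      show "(\<lambda>z. fst (F (fst z, 1 - snd z))) \<in> (T \<inter> e -` U) \<times> {0..1} \<rightarrow> - {0}"
      proof
        fix z assume "z \<in> (T \<inter> e -` U) \<times> {0..1::real}"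
        then have "F (fst z, 1 - snd z) \<in> S"
          by (intro funcset_mem[OF F(2)]) auto
        then show "fst (F (fst z, 1 - snd z)) \<in> - {0}"
          using nz by simp
      qed
    qed (use F(3) in \<open>auto simp: e_def\<close>)
    \<comment> \<open>The second robot already starts at \<open>2\<close>, so its path is lifted
      forwards and ends at a logarithm of \<open>snd q\<close>.\<close>
    obtain k' where k': "continuous_on ((T \<inter> e -` V) \<times> {0..1::real}) k'"
      "\<And>z. z \<in> (T \<inter> e -` V) \<times> {0..1} \<Longrightarrow> snd (F' z) = exp (k' z)"
    proof (rule covering_space_lift_homotopy_alt[OF covering_space_exp_punctured_plane,
        of "T \<inter> e -` V" "\<lambda>z. snd (F' z)" "\<lambda>_. Ln 2"])
      show "continuous_on ((T \<inter> e -` V) \<times> {0..1}) (\<lambda>z. snd (F' z))"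
        by (intro continuous_intros F'(1))
      show "(\<lambda>z. snd (F' z)) \<in> (T \<inter> e -` V) \<times> {0..1} \<rightarrow> - {0}"
        using nz funcset_mem[OF F'(2)] by auto
    qed (use F'(3) in \<open>auto simp: e_def\<close>)
    show False
    proof (rule torus_no_two_logarithms[of "T \<inter> e -` U" "T \<inter> e -` V" "\<lambda>q. k (q, 1)" "\<lambda>q. k' (q, 1)",
        folded T_def])
      show "continuous_on (T \<inter> e -` U) (\<lambda>q. k (q, 1))" "continuous_on (T \<inter> e -` V) (\<lambda>q. k' (q, 1))"
        by (auto intro!: continuous_intros continuous_on_compose2[OF k(1)] continuous_on_compose2[OF k'(1)])
      show "exp (k (q, 1)) = fst q" if "q \<in> T \<inter> e -` U" for q
        using k(2)[of "(q, 1)"] F(3)[OF that] that by (simp add: e_def)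
      show "exp (k' (q, 1)) = snd q" if "q \<in> T \<inter> e -` V" for q
        using k'(2)[of "(q, 1)"] F'(3)[OF that] that by (simp add: e_def)
    qed (use op U V UV eT in auto)
  qed
  note two = this
  have empty: "\<exists>s. motion_planner (top_of_set S) {} s"
    by (simp add: motion_planner_def)
  have "3 \<le> k"
    if W: "\<And>i. i < k \<Longrightarrow> openin (top_of_set (S \<times> S)) (W i) \<and> (\<exists>s. motion_planner (top_of_set S) (W i) s)"
      and cov: "(\<Union>i<k. W i) = S \<times> S" for k :: nat and W
  proof (rule ccontr)
    assume "\<not> 3 \<le> k"
    \<comment> \<open>Padding with empty sets, which have a planner trivially, reduces fewer than
      three sets to the case of exactly two.\<close>
    define W' where "W' i = (if i < k then W i else {})" for i
    have "W' 0 \<union> W' 1 = (\<Union>i<k. W i)"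
    proof -
      have "k = 0 \<or> k = 1 \<or> k = 2"
        using \<open>\<not> 3 \<le> k\<close> by auto
      then show ?thesis
        by (elim disjE) (simp_all add: W'_def lessThan_Suc numeral_2_eq_2 Un_commute)
    qed
    moreover have "openin (top_of_set (S \<times> S)) (W' i) \<and> (\<exists>s. motion_planner (top_of_set S) (W' i) s)" for i
      using W empty by (simp add: W'_def)
    ultimately show False
      using two cov by metis
  qed
  note bound = this
  show ?thesis
    unfolding topological_complexity_def
  proof (intro Inf_greatest, elim CollectE exE conjE)
    fix x :: enat and k and W :: "nat \<Rightarrow> ((complex \<times> complex) \<times> (complex \<times> complex)) set"
    assume "x = enat k" "\<forall>i<k. openin (prod_topology (top_of_set S) (top_of_set S)) (W i) \<and>
        (\<exists>s. motion_planner (top_of_set S) (W i) s)"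
      "(\<Union>i<k. W i) = topspace (prod_topology (top_of_set S) (top_of_set S))"
    then show "3 \<le> x"
      using bound[of k W] by (simp add: numeral_eq_enat)
  qed
qed

section \<open>Null-homotopic subsets and the upper bound\<close>

lemma openin_Collect_less:
  assumes "continuous_on S f" "continuous_on S (g :: _ \<Rightarrow> real)"
  shows "openin (top_of_set S) {p \<in> S. f p < g p}"
proof -
  have "openin (top_of_set S) (S \<inter> (\<lambda>p. g p - f p) -` {0<..})"
    using assms by (intro continuous_openin_preimage_gen continuous_intros) auto
  moreover have "S \<inter> (\<lambda>p. g p - f p) -` {0<..} = {p \<in> S. f p < g p}"
    by auto
  ultimately show ?thesis
    by simp
qed

text \<open>The categorical subsets of Lusternik--Schnirelmann theory: the contraction may leave
  \<open>P\<close> but stays in \<open>S\<close>.\<close>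

definition nullhomotopic_in :: "'a::topological_space set \<Rightarrow> 'a set \<Rightarrow> bool" where
  "nullhomotopic_in S P \<longleftrightarrow> (\<exists>c. homotopic_with_canon (\<lambda>_. True) P S id (\<lambda>_. c))"

text \<open>Each point follows its track to the common constant. This later links configurations
  lying in the same piece.\<close>

lemma nullhomotopic_in_path_component:
  assumes "nullhomotopic_in S P" "x \<in> P" "y \<in> P"
  shows "path_component S x y"
proof -
  obtain c where c: "homotopic_with_canon (\<lambda>_. True) P S id (\<lambda>_. c)"
    using assms by (auto simp: nullhomotopic_in_def)
  have "path_component S z c" if "z \<in> P" for z
  proof -
    have "homotopic_with_canon (\<lambda>_. True) {z} S id (\<lambda>_. c)"
      using homotopic_with_subset_left[OF c, of "{z}"] that by simp
    then have "homotopic_with_canon (\<lambda>_. True) {z} S (\<lambda>_. z) (\<lambda>_. c)"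
      by (rule homotopic_with_eq) auto
    then show ?thesis
      by (auto simp: homotopic_constant_maps simp flip: null_topspace_iff_trivial)
  qed
  then show ?thesis
    using assms by (meson path_component_sym path_component_trans)
qed

text \<open>The end point of the contraction can be moved anywhere along a path. A common end point
  is what allows contractions to be glued over disjoint pieces and concatenated in a
  planner.\<close>

lemma nullhomotopic_in_path_connected:
  assumes "nullhomotopic_in S P" "path_connected S" "c \<in> S"
  shows "homotopic_with_canon (\<lambda>_. True) P S id (\<lambda>_. c)"
proof (cases "P = {}")
  case True
  show ?thesis
    unfolding True by (rule homotopic_with_canon_on_empty)
next
  case False
  obtain d where d: "homotopic_with_canon (\<lambda>_. True) P S id (\<lambda>_. d)"
    using assms by (auto simp: nullhomotopic_in_def)
  then have "d \<in> S"
    using homotopic_with_imp_subset2[OF d] False by auto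
  then have "homotopic_with_canon (\<lambda>_. True) P S (\<lambda>_. d) (\<lambda>_. c)"
    using assms by (simp add: homotopic_constant_maps path_connected_component)
  with d show ?thesis
    by (rule homotopic_with_trans)
qed

text \<open>Pieces are contracted by coordinates: the inclusion is deformed to a map that factors
  through a contractible parameter set \<open>K\<close>. In the next lemma \<open>f\<close> is an
  exact coordinate system and no deformation occurs.\<close>

lemma nullhomotopic_in_through_contractible:
  assumes hom: "homotopic_with_canon (\<lambda>_. True) P S id (g \<circ> f)"
    and "continuous_on P f" "f \<in> P \<rightarrow> K" "continuous_on K g" "g \<in> K \<rightarrow> S" "contractible K"
  shows "nullhomotopic_in S P"
  using nullhomotopic_through_contractible[OF assms(2-6)] homotopic_with_trans[OF hom]
  unfolding nullhomotopic_in_def by metis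

lemma nullhomotopic_in_factor:
  assumes "P \<subseteq> S" "\<And>p. p \<in> P \<Longrightarrow> g (f p) = p"
    and "continuous_on P f" "f \<in> P \<rightarrow> K" "continuous_on K g" "g \<in> K \<rightarrow> S" "contractible K"
  shows "nullhomotopic_in S P"
proof (rule nullhomotopic_in_through_contractible[OF _ assms(3-)])
  show "homotopic_with_canon (\<lambda>_. True) P S id (g \<circ> f)"
    using assms(1,2) by (intro homotopic_with_equal) auto
qed

text \<open>Disjoint open pieces are clopen in their union, so contractions to one common point
  glue.\<close>

lemma nullhomotopic_in_Union:
  fixes S :: "'a::euclidean_space set"
  assumes null: "\<And>P. P \<in> \<F> \<Longrightarrow> nullhomotopic_in S P"
    and op: "\<And>P. P \<in> \<F> \<Longrightarrow> openin (top_of_set S) P"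
    and disj: "pairwise disjnt \<F>" and pc: "path_connected S"
  shows "nullhomotopic_in S (\<Union>\<F>)"
proof (cases "S = {}")
  case True
  then have empty: "\<Union>\<F> = {}"
    using op openin_imp_subset by blast
  show ?thesis
    unfolding nullhomotopic_in_def empty by (intro exI homotopic_with_canon_on_empty)
next
  case False
  then obtain c where "c \<in> S"
    by blast
  have op': "openin (top_of_set (\<Union>\<F>)) P" if "\<P> \<subseteq> \<F>" "P = \<Union>\<P>" for P \<P>
    using that op by (intro openin_subset_trans[of S P "\<Union>\<F>"]) (auto dest: openin_imp_subset)
  have "homotopic_with_canon (\<lambda>_. True) (\<Union>\<F>) S id (\<lambda>_. c)"
  proof (rule homotopic_on_clopen_Union)
    fix P assume P: "P \<in> \<F>"
    show "homotopic_with_canon (\<lambda>_. True) P S id (\<lambda>_. c)"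
      using null[OF P] pc \<open>c \<in> S\<close> by (rule nullhomotopic_in_path_connected)
    show "openin (top_of_set (\<Union>\<F>)) P"
      using op'[of "{P}"] P by simp
    have eq: "\<Union>\<F> - \<Union>(\<F> - {P}) = P"
      using P disj by (auto simp: pairwise_def disjnt_iff)
    have "openin (top_of_set (\<Union>\<F>)) (\<Union>(\<F> - {P}))"
      by (rule op'[of "\<F> - {P}"]) auto
    then have "closedin (top_of_set (\<Union>\<F>)) (\<Union>\<F> - \<Union>(\<F> - {P}))"
      by (intro closedin_diff) auto
    then show "closedin (top_of_set (\<Union>\<F>)) P"
      unfolding eq .
  qed
  then show ?thesis
    by (auto simp: nullhomotopic_in_def)
qed

text \<open>Contract the start to \<open>c\<close> in the first half of the time, then run the
  contraction of the target backwards.\<close>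

lemma motion_planner_of_nullhomotopies:
  fixes S :: "'a::topological_space set"
  assumes P: "homotopic_with_canon (\<lambda>_. True) P S id (\<lambda>_. c)"
    and Q: "homotopic_with_canon (\<lambda>_. True) Q S id (\<lambda>_. c)"
    and W: "W \<subseteq> P \<times> Q"
  shows "\<exists>F. continuous_on (W \<times> {0..1::real}) F \<and> F \<in> W \<times> {0..1} \<rightarrow> S \<and>
        (\<forall>p\<in>W. F (p, 0) = fst p \<and> F (p, 1) = snd p)"
proof -
  obtain h where h: "continuous_on ({0..1::real} \<times> P) h" "h \<in> {0..1} \<times> P \<rightarrow> S"
      "\<And>x. h (0, x) = x" "\<And>x. h (1, x) = c"
    using P by (auto simp: homotopic_with_def)
  obtain k where k: "continuous_on ({0..1::real} \<times> Q) k" "k \<in> {0..1} \<times> Q \<rightarrow> S"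
      "\<And>x. k (0, x) = x" "\<And>x. k (1, x) = c"
    using Q by (auto simp: homotopic_with_def)
  define F where "F z = (if snd z \<le> 1/2 then h (2 * snd z, fst (fst z)) else k (2 - 2 * snd z, snd (fst z)))"
    for z :: "('a \<times> 'a) \<times> real"
  have "continuous_on (W \<times> {0..1}) F"
    unfolding F_def
  proof (rule continuous_on_cases_le)
    show "continuous_on {x \<in> W \<times> {0..1}. snd x \<le> 1/2} (\<lambda>z. h (2 * snd z, fst (fst z)))"
      using W by (intro continuous_on_compose2[OF h(1)] continuous_intros) auto
    show "continuous_on {x \<in> W \<times> {0..1}. 1/2 \<le> snd x} (\<lambda>z. k (2 - 2 * snd z, snd (fst z)))"
      using W by (intro continuous_on_compose2[OF k(1)] continuous_intros) auto
    show "h (2 * snd z, fst (fst z)) = k (2 - 2 * snd z, snd (fst z))" if "snd z = 1/2" for z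
    proof -
      have "2 * snd z = 1" "2 - 2 * snd z = 1"
        using that by simp_all
      then show ?thesis
        by (simp only: h k)
    qed
  qed (auto intro!: continuous_intros)
  moreover have "F \<in> W \<times> {0..1} \<rightarrow> S"
    using h(2) k(2) W by (auto simp: F_def Pi_iff)
  ultimately show ?thesis
    by (intro exI[of _ F]) (auto simp: F_def h k)
qed

text \<open>The product of two open covers by two sets needs only three open sets: comparing the values of the
  partition function \<open>\<phi>\<close> at the two endpoints merges the two mixed products into one
  disjoint union.\<close>

lemma topological_complexity_le_3:
  fixes S :: "'a::euclidean_space set"
  assumes pc: "path_connected S"
    and P: "openin (top_of_set S) P" "nullhomotopic_in S P"
    and Q: "openin (top_of_set S) Q" "nullhomotopic_in S Q" and PQ: "P \<union> Q = S"
  shows "topological_complexity (top_of_set S) \<le> 3"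
proof -
  let ?pl = "\<lambda>W. \<exists>F. continuous_on (W \<times> {0..1::real}) F \<and> F \<in> W \<times> {0..1} \<rightarrow> S \<and>
        (\<forall>p\<in>W. F (p, 0) = fst p \<and> F (p, 1) = snd p)"
  have "closedin (top_of_set S) (S - P)" "closedin (top_of_set S) (S - Q)" "(S - P) \<inter> (S - Q) = {}"
    using P Q PQ by (auto intro: closedin_diff)
  then obtain \<phi> :: "'a \<Rightarrow> real" where \<phi>: "continuous_on S \<phi>" "\<And>x. x \<in> S \<Longrightarrow> \<phi> x \<in> closed_segment 0 1"
      "\<And>x. x \<in> S \<Longrightarrow> \<phi> x = 0 \<longleftrightarrow> x \<in> S - P" "\<And>x. x \<in> S \<Longrightarrow> \<phi> x = 1 \<longleftrightarrow> x \<in> S - Q"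
    by (rule Urysohn_local_strong[of S "S - P" "S - Q" 0 "1::real"]) (simp, blast)
  have \<phi>01: "0 \<le> \<phi> x" "\<phi> x \<le> 1" if "x \<in> S" for x
    using \<phi>(2)[OF that] by (auto simp: closed_segment_eq_real_ivl)
  have inP: "x \<in> P" if "x \<in> S" "0 < \<phi> x" for x
    using \<phi>(3)[of x] that by auto
  have inQ: "x \<in> Q" if "x \<in> S" "\<phi> x < 1" for x
    using \<phi>(4)[of x] that by auto
  have c1: "continuous_on (S \<times> S) (\<lambda>p. \<phi> (fst p))" and c2: "continuous_on (S \<times> S) (\<lambda>p. \<phi> (snd p))"
    by (auto intro!: continuous_on_compose2[OF \<phi>(1)] continuous_intros)
  \<comment> \<open>As \<open>\<phi>\<close> takes values in the unit interval, vanishes exactly off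
    \<open>P\<close> and equals \<open>1\<close> exactly off \<open>Q\<close>, \<open>less\<close>
    lies in \<open>Q \<times> P\<close> and \<open>greater\<close> in \<open>P \<times> Q\<close>.
    In the remaining pairs the two values agree; they are positive or below \<open>1\<close>, so
    \<open>pos\<close> and \<open>small\<close> take care of them.\<close>
  define less where "less = {p \<in> S \<times> S. \<phi> (fst p) < \<phi> (snd p)}"
  define greater where "greater = {p \<in> S \<times> S. \<phi> (fst p) > \<phi> (snd p)}"
  define pos where "pos = {p \<in> S \<times> S. 0 < \<phi> (fst p) \<and> 0 < \<phi> (snd p)}"
  define small where "small = {p \<in> S \<times> S. \<phi> (fst p) < 1 \<and> \<phi> (snd p) < 1}"
  have op: "openin (top_of_set (S \<times> S)) less" "openin (top_of_set (S \<times> S)) greater"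
    "openin (top_of_set (S \<times> S)) pos" "openin (top_of_set (S \<times> S)) small"
  proof -
    have "pos = {p \<in> S \<times> S. 0 < \<phi> (fst p)} \<inter> {p \<in> S \<times> S. 0 < \<phi> (snd p)}"
      "small = {p \<in> S \<times> S. \<phi> (fst p) < 1} \<inter> {p \<in> S \<times> S. \<phi> (snd p) < 1}"
      by (auto simp: pos_def small_def)
    then show "openin (top_of_set (S \<times> S)) less" "openin (top_of_set (S \<times> S)) greater"
      "openin (top_of_set (S \<times> S)) pos" "openin (top_of_set (S \<times> S)) small"
      unfolding less_def greater_def by (auto intro!: openin_Int openin_Collect_less c1 c2)
  qed
  \<comment> \<open>A nonempty \<open>S\<close> supplies the common end point of the contractions;
    the empty case is treated separately.\<close>
  have pl: "?pl W" if "W \<subseteq> A \<times> B" "nullhomotopic_in S A" "nullhomotopic_in S B" for A B W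
  proof (cases "S = {}")
    case True
    have "A = {}"
    proof -
      obtain c where "homotopic_with_canon (\<lambda>_. True) A S id (\<lambda>_. c)"
        using \<open>nullhomotopic_in S A\<close> by (auto simp: nullhomotopic_in_def)
      from homotopic_with_imp_subset1[OF this] True show ?thesis
        by simp
    qed
    then have "W = {}"
      using that by auto
    then show ?thesis
      by simp
  next
    case False
    then obtain c where "c \<in> S"
      by blast
    then show ?thesis
      using that pc
      by (intro motion_planner_of_nullhomotopies[of A S c B] nullhomotopic_in_path_connected) auto
  qed
  have "?pl less"
  proof (rule pl)
    show "less \<subseteq> Q \<times> P"
    proof
      fix p assume "p \<in> less"
      then show "p \<in> Q \<times> P"
        using inP[of "snd p"] inQ[of "fst p"] \<phi>01(1)[of "fst p"] \<phi>01(2)[of "snd p"]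
        by (cases p) (auto simp: less_def)
    qed
  qed (use P Q in auto)
  then obtain F where F: "continuous_on (less \<times> {0..1::real}) F" "F \<in> less \<times> {0..1} \<rightarrow> S"
        "\<forall>p\<in>less. F (p, 0) = fst p \<and> F (p, 1) = snd p"
    by blast
  have "?pl greater"
  proof (rule pl)
    show "greater \<subseteq> P \<times> Q"
    proof
      fix p assume "p \<in> greater"
      then show "p \<in> P \<times> Q"
        using inP[of "fst p"] inQ[of "snd p"] \<phi>01(1)[of "snd p"] \<phi>01(2)[of "fst p"]
        by (cases p) (auto simp: greater_def)
    qed
  qed (use P Q in auto)
  then obtain F' where F': "continuous_on (greater \<times> {0..1::real}) F'" "F' \<in> greater \<times> {0..1} \<rightarrow> S"
        "\<forall>p\<in>greater. F' (p, 0) = fst p \<and> F' (p, 1) = snd p"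
    by blast
  have disj: "less \<inter> greater = {}"
    by (auto simp: less_def greater_def)
  have mid: "?pl (less \<union> greater)"
  proof (intro exI conjI)
    let ?F = "\<lambda>z. if fst z \<in> less then F z else F' z"
    have "openin (top_of_set (less \<union> greater)) less" "openin (top_of_set (less \<union> greater)) greater"
      using op by (auto intro!: openin_subset_trans[of "S \<times> S"] simp: less_def greater_def)
    then have "openin (top_of_set (less \<times> {0..1} \<union> greater \<times> {0..1})) (less \<times> {0..1::real})"
      "openin (top_of_set (less \<times> {0..1} \<union> greater \<times> {0..1})) (greater \<times> {0..1::real})"
      by (auto simp flip: Sigma_Un_distrib1 intro!: openin_Times)
    then have "continuous_on (less \<times> {0..1} \<union> greater \<times> {0..1}) ?F"
      by (rule continuous_on_cases_local_open) (use F(1) F'(1) disj in auto)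
    then show "continuous_on ((less \<union> greater) \<times> {0..1}) ?F"
      by (simp add: Sigma_Un_distrib1)
    show "?F \<in> (less \<union> greater) \<times> {0..1} \<rightarrow> S"
      using F(2) F'(2) by (auto simp: Pi_iff)
    show "\<forall>p\<in>less \<union> greater. ?F (p, 0) = fst p \<and> ?F (p, 1) = snd p"
      using F(3) F'(3) by auto
  qed
  have plpos: "?pl pos"
    using inP P by (intro pl[of _ P P]) (auto simp: pos_def)
  have plsmall: "?pl small"
    using inQ Q by (intro pl[of _ Q Q]) (auto simp: small_def)
  define W where "W i = (if i = 0 then less \<union> greater else if i = 1 then pos else small)" for i :: nat
  have sub: "W i \<subseteq> S \<times> S" for i
    by (auto simp: W_def less_def greater_def pos_def small_def)
  have "openin (top_of_set (S \<times> S)) (W i) \<and> (\<exists>s. motion_planner (top_of_set S) (W i) s)" for i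
    using op mid plpos plsmall unfolding ex_motion_planner_top_of_set_iff[OF sub]
    by (simp add: W_def openin_Un)
  moreover have "(\<Union>i<3. W i) = S \<times> S"
  proof
    show "S \<times> S \<subseteq> (\<Union>i<3. W i)"
    proof
      fix p assume p: "p \<in> S \<times> S"
      then have "p \<in> less \<union> greater \<or> p \<in> pos \<or> p \<in> small"
        using \<phi>01(1)[of "fst p"] by (auto simp: less_def greater_def pos_def small_def)
      then have "p \<in> W 0 \<or> p \<in> W 1 \<or> p \<in> W 2"
        by (simp add: W_def)
      then show "p \<in> (\<Union>i<3. W i)"
        by force
    qed
  qed (use sub in blast)
  ultimately show ?thesis
    unfolding topological_complexity_def
    by (intro Inf_lower CollectI exI[of _ 3] conjI exI[of _ W]) (auto simp: numeral_eq_enat)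
qed

section \<open>The planar lollipop\<close>

lemma config2_homeomorphic_space:
  assumes "X homeomorphic_space Y"
  shows "config2 X homeomorphic_space config2 Y"
proof -
  obtain f g where fg: "homeomorphic_maps X Y f g"
    using assms by (auto simp: homeomorphic_space_def)
  have cont: "continuous_map (config2 A) (config2 B) (map_prod h h)"
    if h: "continuous_map A B h" and k: "\<And>x. x \<in> topspace A \<Longrightarrow> k (h x) = x"
    for A :: "'c topology" and B :: "'d topology" and h k
  proof -
    have "continuous_map (prod_topology A A) (prod_topology B B) (map_prod h h)"
      unfolding map_prod_def case_prod_unfold
      by (intro continuous_map_pairedI continuous_map_compose[OF continuous_map_fst h, unfolded o_def]
          continuous_map_compose[OF continuous_map_snd h, unfolded o_def])
    moreover have "h x \<noteq> h y" if "x \<in> topspace A" "y \<in> topspace A" "x \<noteq> y" for x y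
      using k that by metis
    ultimately show ?thesis
      unfolding config2_def
      by (auto simp: continuous_map_in_subtopology continuous_map_from_subtopology)
  qed
  have "homeomorphic_maps (config2 X) (config2 Y) (map_prod f f) (map_prod g g)"
    using fg cont[of X Y f g] cont[of Y X g f]
    by (auto simp: homeomorphic_maps_def config2_def)
  then show ?thesis
    using homeomorphic_space_def by blast
qed

lemma config2_top_of_set:
  "config2 (top_of_set G) = top_of_set {(x, y) \<in> G \<times> G. x \<noteq> y}"
proof -
  have "(G \<times> G) \<inter> {(x, y). x \<noteq> y} = {(x, y) \<in> G \<times> G. x \<noteq> y}"
    by auto
  then show ?thesis
    by (simp add: config2_def subtopology_subtopology)
qed

definition planar_lollipop :: "complex set" where
  "planar_lollipop = sphere 0 1 \<union> complex_of_real ` {1..2}"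

text \<open>A continuous bijection from a compact space to a Hausdorff space is a homeomorphism. The
  work lies in showing that the fibres of \<open>h\<close> are exactly the classes of
  \<open>identify\<close>.\<close>

lemma lollipop_homeomorphic_planar: "lollipop homeomorphic_space top_of_set planar_lollipop"
proof -
  let ?A = "{(Stick, 1), (Loop, 1)} :: (lollipop_part \<times> complex) set"
  let ?X = "sum_topology lollipop_piece UNIV"
  \<comment> \<open>The stick is reversed: its glued end \<open>1\<close> stays at the junction
    \<open>1\<close> and its free end \<open>0\<close> goes to \<open>2\<close>.\<close>
  define h :: "lollipop_part \<times> complex \<Rightarrow> complex"
    where "h = (\<lambda>(i, z). case i of Stick \<Rightarrow> 2 - z | Loop \<Rightarrow> z)"
  have seg: "closed_segment 0 1 = complex_of_real ` {0..1}"
    using closed_segment_of_real[of 0 1] by (simp add: closed_segment_eq_real_ivl)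
  have parts: "UNIV = {Stick, Loop}"
    using lollipop_part.exhaust by auto
  have qm: "quotient_map ?X lollipop (identify ?A)"
    unfolding lollipop_def by (rule quotient_map_quotient_topology)
  have top: "topspace ?X = Pair Stick ` closed_segment 0 1 \<union> Pair Loop ` sphere 0 1"
    unfolding topspace_sum_topology parts by auto
  have comp: "compactin ?X (Pair i ` topspace (lollipop_piece i))" for i
    by (rule image_compactin[OF _ continuous_map_component_injection])
      (cases i; simp add: compactin_subtopology)+
  have "compact_space ?X"
    unfolding compact_space_def top using compactin_Un[OF comp[of Stick] comp[of Loop]] by simp
  then have "compact_space lollipop"
    using image_compactin[OF _ quotient_imp_continuous_map[OF qm]] quotient_imp_surjective_map[OF qm]
    by (metis compact_space_def)
  have h_cont: "continuous_map ?X (top_of_set planar_lollipop) h"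
  proof -
    have "continuous_map (lollipop_piece i) (top_of_set planar_lollipop) (\<lambda>z. h (i, z))" for i
    proof (cases i)
      case Stick
      have "2 - complex_of_real r \<in> complex_of_real ` {1..2}" if "0 \<le> r" "r \<le> 1" for r
        using that by (intro image_eqI[of _ _ "2 - r"]) auto
      then show ?thesis
        using Stick by (auto simp: h_def seg planar_lollipop_def intro!: continuous_intros)
    qed (auto simp: h_def planar_lollipop_def intro!: continuous_intros)
    then show ?thesis
      by (fastforce simp: continuous_map_def openin_sum_topology)
  qed
  have h_eq: "h p = h q \<longleftrightarrow> identify ?A p = identify ?A q" if "p \<in> topspace ?X" "q \<in> topspace ?X" for p q
  proof -
    have id_eq: "identify ?A p = identify ?A q \<longleftrightarrow> p = q \<or> p \<in> ?A \<and> q \<in> ?A"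
      by (auto simp: identify_def)
    have "2 - complex_of_real r = w \<longleftrightarrow> r = 1 \<and> w = 1" if "0 \<le> r" "r \<le> 1" "cmod w = 1" for r w
    proof
      assume "2 - complex_of_real r = w"
      moreover from this have "cmod (complex_of_real (2 - r)) = 1"
        using that by simp
      ultimately show "r = 1 \<and> w = 1"
        using that by (simp only: norm_of_real) auto
    qed auto
    then have *: "2 - complex_of_real r = w \<longleftrightarrow> r = 1 \<and> w = 1" "w = 2 - complex_of_real r \<longleftrightarrow> r = 1 \<and> w = 1"
      if "0 \<le> r" "r \<le> 1" "cmod w = 1" for r w
      using that by (blast, metis)
    have "(\<exists>r. 0 \<le> r \<and> r \<le> 1 \<and> p = (Stick, complex_of_real r)) \<or> (\<exists>w. cmod w = 1 \<and> p = (Loop, w))"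
      if "p \<in> topspace ?X" for p
      using that unfolding top seg by auto
    from this[OF that(1)] this[OF that(2)] show ?thesis
      unfolding id_eq by (elim disjE exE conjE) (auto simp: h_def *)
  qed
  have h_im: "h ` topspace ?X = planar_lollipop"
  proof -
    have "(\<lambda>r. 2 - r) ` {0..1::real} = {1..2}"
      by simp
    then have "complex_of_real ` {1..2} = (\<lambda>r. complex_of_real (2 - r)) ` {0..1}"
      by (metis image_image)
    then show ?thesis
      unfolding top image_Un seg planar_lollipop_def by (simp add: h_def image_image Un_commute)
  qed
  obtain g where g: "continuous_map lollipop (top_of_set planar_lollipop) g"
    "g ` topspace lollipop = h ` topspace ?X" "\<And>x. x \<in> topspace ?X \<Longrightarrow> g (identify ?A x) = h x"
  proof (rule quotient_map_lift_exists[OF qm h_cont])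
    show "h x = h y" if "x \<in> topspace ?X" "y \<in> topspace ?X" "identify ?A x = identify ?A y" for x y
      using h_eq[OF that(1,2)] that(3) by (rule iffD2)
  next
    fix g assume "continuous_map lollipop (top_of_set planar_lollipop) g"
      "g ` topspace lollipop = h ` topspace ?X" "\<And>x. x \<in> topspace ?X \<Longrightarrow> g (identify ?A x) = h x"
    then show thesis
      by (rule that)
  qed
  have "inj_on g (topspace lollipop)"
  proof (rule inj_onI)
    fix x y assume xy: "x \<in> topspace lollipop" "y \<in> topspace lollipop" "g x = g y"
    obtain p where p: "p \<in> topspace ?X" "x = identify ?A p"
      using xy(1) unfolding quotient_imp_surjective_map[OF qm, symmetric] by (rule imageE)
    obtain q where q: "q \<in> topspace ?X" "y = identify ?A q"
      using xy(2) unfolding quotient_imp_surjective_map[OF qm, symmetric] by (rule imageE)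
    show "x = y"
      using h_eq[OF p(1) q(1)] xy(3) unfolding p(2) q(2) g(3)[OF p(1)] g(3)[OF q(1)] by (rule iffD1)
  qed
  then have "homeomorphic_map lollipop (top_of_set planar_lollipop) g"
    using g \<open>compact_space lollipop\<close> h_im
    by (intro continuous_imp_homeomorphic_map) (auto simp: Hausdorff_space_subtopology)
  then show ?thesis
    using homeomorphic_map_imp_homeomorphic_space by blast
qed

definition planar_config :: "(complex \<times> complex) set" where
  "planar_config = {(x, y) \<in> planar_lollipop \<times> planar_lollipop. x \<noteq> y}"

section \<open>Circle, stick and the retraction to the junction\<close>

lemma planar_lollipop_cases [consumes 1, case_names circle stick]:
  assumes "x \<in> planar_lollipop"
  obtains "cmod x = 1" | r where "1 \<le> r" "r \<le> 2" "x = complex_of_real r"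
  using assms by (auto simp: planar_lollipop_def)

text \<open>Describes the circle without the junction by a strict inequality in a continuous
  function, so that pieces defined through it are open. The condition \<open>1 < cmod x\<close> in
  the next lemma does the same for the stick.\<close>

lemma planar_lollipop_circle_iff:
  assumes "x \<in> planar_lollipop"
  shows "Re x < 1 \<longleftrightarrow> cmod x = 1 \<and> x \<noteq> 1"
  using assms
proof (cases rule: planar_lollipop_cases)
  case circle
  then have "Re x \<noteq> 1" if "x \<noteq> 1"
    using that by (auto simp: cmod_def complex_eq_iff)
  then show ?thesis
    using circle abs_Re_le_cmod[of x] by auto
qed auto

lemma planar_lollipop_stick_iff:
  assumes "x \<in> planar_lollipop"
  shows "1 < cmod x \<longleftrightarrow> (\<exists>r\<in>{1<..2}. x = complex_of_real r)"
  using assms by (cases rule: planar_lollipop_cases) auto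

text \<open>The path from \<open>x\<close> to the junction: on the circle the chord towards \<open>1\<close> is projected
  radially; the minimum leaves the stick, where the norm is at least \<open>1\<close>, unaffected.\<close>

definition retract_path :: "real \<Rightarrow> complex \<Rightarrow> complex" where
  "retract_path t x = (let w = (1 - t) *\<^sub>R x + of_real t in w / of_real (min 1 (cmod w)))"

text \<open>A chord from the circle to \<open>1\<close> passes through the origin only when it is a
  diameter; on the stick the point remains a real number at least \<open>1\<close>.\<close>

lemma retract_path_nonzero:
  assumes x: "x \<in> planar_lollipop" "x \<noteq> -1" and t: "0 \<le> t" "t \<le> 1"
  shows "(1 - t) *\<^sub>R x + of_real t \<noteq> 0"
proof
  assume 0: "(1 - t) *\<^sub>R x + of_real t = 0"
  then have eq: "(1 - t) *\<^sub>R x = - of_real t"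
    by (simp add: eq_neg_iff_add_eq_0)
  then have "cmod ((1 - t) *\<^sub>R x) = cmod (- of_real t :: complex)"
    by simp
  then have norm: "(1 - t) * cmod x = t"
    using t by simp
  show False
    using x(1)
  proof (cases rule: planar_lollipop_cases)
    case circle
    then have "t = 1/2"
      using norm by simp
    then have "x = 2 *\<^sub>R ((1 - t) *\<^sub>R x)"
      by (simp only:) simp
    also have "\<dots> = -1"
      unfolding eq by (simp add: \<open>t = 1/2\<close> scaleR_conv_of_real)
    finally show False
      using x(2) by simp
  next
    case (stick r)
    have "complex_of_real ((1 - t) * r + t) = 0"
      using 0 stick by (simp add: scaleR_conv_of_real)
    then have "(1 - t) * r + t = 0"
      by (simp only: of_real_eq_0_iff)
    moreover have "(1 - t) * r \<ge> (1 - t) * 1"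
      using t stick by (intro mult_left_mono) auto
    ultimately show False
      by simp
  qed
qed

text \<open>The distance bound is what excludes collisions: a robot strictly nearer to the junction
  stays strictly nearer while it moves there.\<close>

lemma retract_path_props:
  assumes x: "x \<in> planar_lollipop" "x \<noteq> -1" and t: "0 \<le> t" "t \<le> 1"
  shows "retract_path t x \<in> planar_lollipop" "cmod (retract_path t x - 1) \<le> cmod (x - 1)"
proof -
  define w where "w = (1 - t) *\<^sub>R x + of_real t"
  have w0: "w \<noteq> 0"
    using retract_path_nonzero[OF assms] by (simp add: w_def)
  have "retract_path t x \<in> planar_lollipop \<and> cmod (retract_path t x - 1) \<le> cmod (x - 1)"
    using x(1)
  proof (cases rule: planar_lollipop_cases)
    case circle
    have "cmod w \<le> cmod ((1 - t) *\<^sub>R x) + cmod (of_real t)"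
      unfolding w_def by (rule norm_triangle_ineq)
    then have w1: "cmod w \<le> 1"
      using circle t by simp
    then have rp: "retract_path t x = w / of_real (cmod w)"
      by (simp add: retract_path_def Let_def min_def flip: w_def)
    have u: "cmod (w / of_real (cmod w)) = 1"
      using w0 by (simp add: norm_divide)
    \<comment> \<open>On the unit circle the distance to \<open>1\<close> decreases as the real part
      grows, so it suffices that the projection does not lower the real part.\<close>
    have dist: "(cmod (z - 1))\<^sup>2 = 2 - 2 * Re z" if "cmod z = 1" for z
      using that cmod_power2[of z] cmod_power2[of "z - 1"] by (simp add: power2_eq_square algebra_simps)
    have "cmod ((1 - t) *\<^sub>R x) - cmod (- of_real t :: complex) \<le> cmod ((1 - t) *\<^sub>R x - (- of_real t))"
      by (rule norm_triangle_ineq2)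
    then have w2: "1 - 2 * t \<le> cmod w"
      using circle t by (simp add: w_def)
    have c: "-1 \<le> Re x" "Re x \<le> 1"
      using abs_Re_le_cmod[of x] circle by auto
    \<comment> \<open>For a nonnegative real part use \<open>cmod w \<le> 1\<close>; for a negative
      one use the lower bound \<open>1 - 2 * t\<close> for \<open>cmod w\<close>.\<close>
    have "Re x * cmod w \<le> (1 - t) * Re x + t"
    proof (cases "0 \<le> Re x")
      case True
      then have "Re x * cmod w \<le> Re x * 1"
        using w1 by (intro mult_left_mono)
      also have "\<dots> \<le> (1 - t) * Re x + t"
        using mult_left_mono[OF c(2) t(1)] by (simp add: algebra_simps)
      finally show ?thesis .
    next
      case False
      then have "Re x * cmod w \<le> Re x * (1 - 2 * t)"
        using w2 by (intro mult_left_mono_neg) auto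
      also have "\<dots> \<le> (1 - t) * Re x + t"
        using mult_left_mono[OF c(1) t(1)] by (simp add: algebra_simps)
      finally show ?thesis .
    qed
    also have "\<dots> = Re w"
      by (simp add: w_def)
    finally have "Re x \<le> Re (w / of_real (cmod w))"
      using w0 by (simp add: field_simps)
    then have "(cmod (w / of_real (cmod w) - 1))\<^sup>2 \<le> (cmod (x - 1))\<^sup>2"
      using dist[OF u] dist[OF circle] by simp
    then have "cmod (w / of_real (cmod w) - 1) \<le> cmod (x - 1)"
      by (rule power2_le_imp_le) simp
    then show ?thesis
      unfolding rp using u by (simp add: planar_lollipop_def)
  next
    case (stick r)
    define s where "s = (1 - t) * r + t"
    have s: "w = of_real s"
      by (simp add: w_def s_def stick scaleR_conv_of_real)
    have "(1 - t) * r \<ge> (1 - t) * 1" "(1 - t) * r \<le> (1 - t) * 2" "t * r \<ge> t * 1"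
      using t stick by (intro mult_left_mono; simp)+
    then have s12: "1 \<le> s" "s \<le> 2" "s \<le> r"
      using t by (auto simp: s_def algebra_simps)
    then have "retract_path t x = of_real s"
      by (simp add: retract_path_def Let_def s flip: w_def)
    moreover have "cmod (of_real s - 1) = s - 1" "cmod (x - 1) = r - 1"
      using s12 norm_of_real[of "s - 1", where 'a = complex] norm_of_real[of "r - 1", where 'a = complex] by (auto simp: stick)
    ultimately show ?thesis
      using s12 by (auto simp: planar_lollipop_def)
  qed
  then show "retract_path t x \<in> planar_lollipop" "cmod (retract_path t x - 1) \<le> cmod (x - 1)"
    by auto
qed

lemma retract_path_0: "x \<in> planar_lollipop \<Longrightarrow> retract_path 0 x = x"
  by (cases rule: planar_lollipop_cases) (auto simp: retract_path_def Let_def)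

lemma retract_path_1 [simp]: "retract_path 1 x = 1"
  by (simp add: retract_path_def Let_def)

lemma continuous_on_retract_path:
  "continuous_on ({0..1} \<times> (planar_lollipop - {-1})) (\<lambda>z. retract_path (fst z) (snd z))"
  unfolding retract_path_def Let_def
  by (intro continuous_intros) (use retract_path_nonzero in \<open>auto simp: min_def\<close>)

definition closer_first :: "(complex \<times> complex) set" where
  "closer_first = {(x, y) \<in> planar_config. cmod (x - 1) < cmod (y - 1)}"

lemma cmod_diff_1_le_2:
  assumes "y \<in> planar_lollipop"
  shows "cmod (y - 1) \<le> 2"
  using assms
proof (cases rule: planar_lollipop_cases)
  case circle
  then show ?thesis
    using norm_triangle_ineq4[of y 1] by simp
next
  case (stick r)
  then show ?thesis
    using norm_of_real[of "r - 1", where 'a = complex] by simp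
qed

text \<open>The nearer robot retracts to the junction while the other one waits.\<close>

lemma closer_first_homotopic:
  "homotopic_with_canon (\<lambda>_. True) closer_first planar_config id (\<lambda>(x, y). (1, y))"
proof -
  \<comment> \<open>No point is farther than \<open>2\<close> from the junction, and
    \<open>-1\<close> has exactly this distance. So the nearer robot is never at the one point where
    \<open>retract_path\<close> breaks down.\<close>
  have mem: "x \<in> planar_lollipop" "y \<in> planar_lollipop" "x \<noteq> -1" if "(x, y) \<in> closer_first" for x y
    using that cmod_diff_1_le_2[of y] by (auto simp: closer_first_def planar_config_def)
  let ?h = "\<lambda>z::real \<times> complex \<times> complex. (retract_path (fst z) (fst (snd z)), snd (snd z))"
  have "continuous_on ({0..1} \<times> closer_first) ?h"
  proof (intro continuous_on_Pair)
    have "continuous_on ({0..1} \<times> closer_first) (\<lambda>z. (fst z, fst (snd z)))"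
      by (intro continuous_intros)
    moreover have "(\<lambda>z. (fst z, fst (snd z))) ` ({0..1} \<times> closer_first) \<subseteq> {0..1} \<times> (planar_lollipop - {-1})"
      using mem by auto
    ultimately show "continuous_on ({0..1} \<times> closer_first) (\<lambda>z. retract_path (fst z) (fst (snd z)))"
      using continuous_on_compose2[OF continuous_on_retract_path] by fastforce
  qed (intro continuous_intros)
  moreover have "?h z \<in> planar_config" if zin: "z \<in> {0..1} \<times> closer_first" for z
  proof -
    obtain t x y where z: "z = (t, x, y)" "0 \<le> t" "t \<le> 1" "(x, y) \<in> closer_first"
      using zin by (cases z rule: prod_cases3) auto
    have "cmod (retract_path t x - 1) < cmod (y - 1)"
      using retract_path_props(2)[OF mem(1,3)[OF z(4)] z(2,3)] z(4) by (auto simp: closer_first_def)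
    then show ?thesis
      using retract_path_props(1)[OF mem(1,3)[OF z(4)] z(2,3)] mem(2)[OF z(4)] z(1)
      by (auto simp: planar_config_def)
  qed
  ultimately show ?thesis
    using mem retract_path_0
    by (subst homotopic_with) (auto intro!: exI[of _ ?h])
qed

section \<open>The angle on the circle without the junction\<close>

lemma cis_Arg2pi_unit: "cmod x = 1 \<Longrightarrow> cis (Arg2pi x) = x"
  using complex_norm_eq_1_exp[of x] by (simp add: cis_conv_exp)

lemma Arg2pi_cis: "0 \<le> t \<Longrightarrow> t < 2 * pi \<Longrightarrow> Arg2pi (cis t) = t"
  using Arg2pi_exp[of "\<i> * t"] by (simp add: cis_conv_exp)

lemma Arg2pi_pos_circle:
  assumes "cmod x = 1" "x \<noteq> 1"
  shows "0 < Arg2pi x"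
  using assms cis_Arg2pi_unit[of x] Arg2pi[of x] by (cases "Arg2pi x = 0") auto

text \<open>The branch cut of \<open>Arg2pi\<close>, the nonnegative real axis, meets the unit
  circle only in the junction.\<close>

lemma continuous_on_Arg2pi_circle: "continuous_on (sphere 0 1 - {1}) Arg2pi"
proof (intro continuous_at_imp_continuous_on ballI continuous_at_Arg2pi)
  fix x :: complex assume "x \<in> sphere 0 1 - {1}"
  then show "x \<notin> \<real>\<^sub>\<ge>\<^sub>0"
    using Arg2pi_pos_circle[of x] Arg2pi_eq_0[of x] by (auto simp: complex_nonneg_Reals_iff complex_is_Real_iff)
qed

lemma cis_mem_planar_lollipop [simp]: "cis t \<in> planar_lollipop"
  and one_mem_planar_lollipop [simp]: "1 \<in> planar_lollipop"
  and of_real_mem_planar_lollipop: "1 \<le> r \<Longrightarrow> r \<le> 2 \<Longrightarrow> complex_of_real r \<in> planar_lollipop"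
  by (auto simp: planar_lollipop_def)

lemma cis_ne_1: "0 < t \<Longrightarrow> t < 2 * pi \<Longrightarrow> cis t \<noteq> 1"
  using Arg2pi_cis[of t] Arg2pi_of_real[of 1] by auto

section \<open>Contractible pieces of the configuration space\<close>

text \<open>The first two sets split \<open>closer_first\<close>, because the farther robot is never
  at the junction. With their swaps they form the first set of the open cover;
  \<open>stick_circle\<close> and \<open>circle_ordered\<close> with their swaps form the
  second.\<close>

definition closer_first_stick :: "(complex \<times> complex) set" where
  "closer_first_stick = {(x, y) \<in> closer_first. 1 < cmod y}"
definition closer_first_circle :: "(complex \<times> complex) set" where
  "closer_first_circle = {(x, y) \<in> closer_first. Re y < 1}"
definition stick_circle :: "(complex \<times> complex) set" where
  "stick_circle = {(x, y) \<in> planar_config. 1 < cmod x \<and> Re y < 1}"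
definition circle_ordered :: "(complex \<times> complex) set" where
  "circle_ordered = {(x, y) \<in> planar_config. Re x < 1 \<and> Re y < 1 \<and> Arg2pi x < Arg2pi y}"

text \<open>Once the nearer robot is at the junction, the position of the other on the half-open
  stick is the only parameter.\<close>

lemma nullhomotopic_closer_first_stick: "nullhomotopic_in planar_config closer_first_stick"
proof (rule nullhomotopic_in_through_contractible)
  let ?f = "\<lambda>p::complex \<times> complex. Re (snd p)" and ?g = "\<lambda>r. (1::complex, complex_of_real r)"
  have *: "\<exists>r\<in>{1<..2}. y = complex_of_real r" if "(x, y) \<in> closer_first_stick" for x y
    using that planar_lollipop_stick_iff[of y] by (auto simp: closer_first_stick_def closer_first_def planar_config_def)
  have sub: "closer_first_stick \<subseteq> closer_first"
    by (auto simp: closer_first_stick_def)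
  show "homotopic_with_canon (\<lambda>_. True) closer_first_stick planar_config id (?g \<circ> ?f)"
    by (rule homotopic_with_eq[OF homotopic_with_subset_left[OF closer_first_homotopic sub]])
      (use * in fastforce)+
  show "continuous_on closer_first_stick ?f" "continuous_on {1<..2} ?g"
    by (intro continuous_intros)+
  show "?f \<in> closer_first_stick \<rightarrow> {1<..2}"
    using * by fastforce
  show "?g \<in> {1<..2} \<rightarrow> planar_config"
    by (auto simp: planar_config_def of_real_mem_planar_lollipop)
  show "contractible {1<..2::real}"
    by (intro convex_imp_contractible) auto
qed

text \<open>Here the remaining parameter is the angle of the farther robot, which ranges over an
  open interval.\<close>

lemma nullhomotopic_closer_first_circle: "nullhomotopic_in planar_config closer_first_circle"
proof (rule nullhomotopic_in_through_contractible)
  let ?f = "\<lambda>p::complex \<times> complex. Arg2pi (snd p)" and ?g = "\<lambda>t. (1::complex, cis t)"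
  have *: "cmod y = 1" "y \<noteq> 1" if "(x, y) \<in> closer_first_circle" for x y
    using that planar_lollipop_circle_iff[of y]
    by (auto simp: closer_first_circle_def closer_first_def planar_config_def)
  have sub: "closer_first_circle \<subseteq> closer_first"
    by (auto simp: closer_first_circle_def)
  show "homotopic_with_canon (\<lambda>_. True) closer_first_circle planar_config id (?g \<circ> ?f)"
    by (rule homotopic_with_eq[OF homotopic_with_subset_left[OF closer_first_homotopic sub]])
      (use * cis_Arg2pi_unit in \<open>auto simp: split: prod.splits\<close>)
  show "continuous_on closer_first_circle ?f"
    by (rule continuous_on_compose2[OF continuous_on_Arg2pi_circle]) (use * in \<open>auto intro!: continuous_intros\<close>)
  show "continuous_on {0<..<2 * pi} ?g"
    by (intro continuous_intros)
  show "?f \<in> closer_first_circle \<rightarrow> {0<..<2 * pi}"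
    using * Arg2pi_pos_circle Arg2pi by fastforce
  show "?g \<in> {0<..<2 * pi} \<rightarrow> planar_config"
    using cis_ne_1 by (fastforce simp: planar_config_def)
  show "contractible {0<..<2 * pi}"
    by (intro convex_imp_contractible) auto
qed

lemma nullhomotopic_stick_circle: "nullhomotopic_in planar_config stick_circle"
proof (rule nullhomotopic_in_factor)
  let ?f = "\<lambda>p::complex \<times> complex. (Re (fst p), Arg2pi (snd p))"
  let ?g = "\<lambda>q. (complex_of_real (fst q), cis (snd q))"
  let ?K = "{1<..2::real} \<times> {0<..<2 * pi}"
  have *: "cmod y = 1" "y \<noteq> 1" "\<exists>r\<in>{1<..2}. x = complex_of_real r" if "(x, y) \<in> stick_circle" for x y
    using that planar_lollipop_circle_iff[of y] planar_lollipop_stick_iff[of x]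
    by (auto simp: stick_circle_def planar_config_def)
  show f: "continuous_on stick_circle ?f"
    by (intro continuous_intros continuous_on_compose2[OF continuous_on_Arg2pi_circle]) (use * in auto)
  show g: "continuous_on ?K ?g"
    by (intro continuous_intros)
  show fK: "?f \<in> stick_circle \<rightarrow> ?K"
    using * Arg2pi_pos_circle Arg2pi by fastforce
  show gK: "?g \<in> ?K \<rightarrow> planar_config"
  proof
    fix q assume "q \<in> ?K"
    then obtain r t where q: "q = (r, t)" "1 < r" "r \<le> 2"
      by auto
    then have "cmod (complex_of_real r) \<noteq> cmod (cis t)"
      by simp
    then show "?g q \<in> planar_config"
      using q by (auto simp: planar_config_def of_real_mem_planar_lollipop simp del: norm_of_real norm_cis)
  qed
  show "stick_circle \<subseteq> planar_config"
    by (auto simp: stick_circle_def)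
  show "?g (?f p) = p" if "p \<in> stick_circle" for p
    using *[of "fst p" "snd p"] cis_Arg2pi_unit that by (cases p) auto
  show "contractible ?K"
    by (intro convex_imp_contractible convex_Times) auto
qed

lemma nullhomotopic_circle_ordered: "nullhomotopic_in planar_config circle_ordered"
proof (rule nullhomotopic_in_factor)
  let ?f = "\<lambda>p::complex \<times> complex. (Arg2pi (fst p), Arg2pi (snd p))"
  let ?g = "\<lambda>q. (cis (fst q), cis (snd q))"
  let ?K = "{q::real \<times> real. 0 < fst q \<and> fst q < snd q \<and> snd q < 2 * pi}"
  have *: "cmod x = 1" "x \<noteq> 1" "cmod y = 1" "y \<noteq> 1" "Arg2pi x < Arg2pi y"
    if "(x, y) \<in> circle_ordered" for x y
    using that planar_lollipop_circle_iff[of y] planar_lollipop_circle_iff[of x]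
    by (auto simp: circle_ordered_def planar_config_def)
  show f: "continuous_on circle_ordered ?f"
    by (intro continuous_intros continuous_on_compose2[OF continuous_on_Arg2pi_circle]) (use * in auto)
  show g: "continuous_on ?K ?g"
    by (intro continuous_intros)
  show fK: "?f \<in> circle_ordered \<rightarrow> ?K"
    using * Arg2pi_pos_circle Arg2pi by fastforce
  show gK: "?g \<in> ?K \<rightarrow> planar_config"
  proof
    fix q assume q: "q \<in> ?K"
    then have "cis (fst q) \<noteq> cis (snd q)"
      using Arg2pi_cis[of "fst q"] Arg2pi_cis[of "snd q"] by force
    then show "?g q \<in> planar_config"
      by (simp add: planar_config_def)
  qed
  show "circle_ordered \<subseteq> planar_config"
    by (auto simp: circle_ordered_def)
  show "?g (?f p) = p" if "p \<in> circle_ordered" for p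
    using *[of "fst p" "snd p"] cis_Arg2pi_unit that by (cases p) auto
  \<comment> \<open>The open triangle of ordered angles is an intersection of three half-planes,
    hence convex.\<close>
  have "?K = {q. (1, 0) \<bullet> q > 0} \<inter> {q. (-1, 1) \<bullet> q > 0} \<inter> {q. (0, 1) \<bullet> q < 2 * pi}"
    by (auto simp: inner_prod_def)
  then show "contractible ?K"
    by (auto intro!: convex_imp_contractible convex_Int convex_halfspace_lt convex_halfspace_gt)
qed

section \<open>Exchanging the robots, openness and covering\<close>

lemma mem_swap_image_iff: "p \<in> prod.swap ` P \<longleftrightarrow> prod.swap p \<in> P"
  by (auto intro: image_eqI[of _ _ "prod.swap p"])

lemma swap_planar_config: "prod.swap p \<in> planar_config \<longleftrightarrow> p \<in> planar_config"
  by (auto simp: planar_config_def)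

lemma nullhomotopic_in_swap:
  assumes "nullhomotopic_in planar_config P"
  shows "nullhomotopic_in planar_config (prod.swap ` P)"
proof -
  obtain c where c: "homotopic_with_canon (\<lambda>_. True) P planar_config id (\<lambda>_. c)"
    using assms by (auto simp: nullhomotopic_in_def)
  have swap: "continuous_on A prod.swap" for A :: "(complex \<times> complex) set"
    unfolding prod.swap_def by (intro continuous_intros)
  have "homotopic_with_canon (\<lambda>_. True) P planar_config (prod.swap \<circ> id) (prod.swap \<circ> (\<lambda>_. c))"
    by (rule homotopic_with_compose_continuous_map_left[OF c]) (auto simp: swap swap_planar_config)
  then have "homotopic_with_canon (\<lambda>_. True) (prod.swap ` P) planar_config
      (prod.swap \<circ> id \<circ> prod.swap) (prod.swap \<circ> (\<lambda>_. c) \<circ> prod.swap)"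
    by (rule homotopic_with_compose_continuous_map_right) (auto simp: swap)
  then show ?thesis
    unfolding nullhomotopic_in_def by (intro exI[of _ "prod.swap c"]) (simp add: o_def id_def)
qed

lemma openin_planar_config_swap:
  assumes "openin (top_of_set planar_config) P"
  shows "openin (top_of_set planar_config) (prod.swap ` P)"
proof -
  have "continuous_on planar_config prod.swap"
    unfolding prod.swap_def by (intro continuous_intros)
  then have "openin (top_of_set planar_config) (planar_config \<inter> prod.swap -` P)"
    using assms by (intro continuous_openin_preimage[of _ _ planar_config]) (auto simp: planar_config_def)
  moreover have "planar_config \<inter> prod.swap -` P = prod.swap ` P"
  proof (rule set_eqI)
    fix p show "p \<in> planar_config \<inter> prod.swap -` P \<longleftrightarrow> p \<in> prod.swap ` P"
      using openin_imp_subset[OF assms] swap_planar_config[of p]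
      unfolding Int_iff vimage_eq mem_swap_image_iff by blast
  qed
  ultimately show ?thesis
    by simp
qed

lemma openin_pieces:
  "openin (top_of_set planar_config) closer_first_stick"
  "openin (top_of_set planar_config) closer_first_circle"
  "openin (top_of_set planar_config) stick_circle"
  "openin (top_of_set planar_config) circle_ordered"
proof -
  let ?S = planar_config
  have closer: "openin (top_of_set ?S) {p \<in> ?S. cmod (fst p - 1) < cmod (snd p - 1)}"
    by (intro openin_Collect_less continuous_intros)
  have stick: "openin (top_of_set ?S) {p \<in> ?S. 1 < cmod (fst p)}" "openin (top_of_set ?S) {p \<in> ?S. 1 < cmod (snd p)}"
    by (intro openin_Collect_less continuous_intros)+
  have circle: "openin (top_of_set ?S) {p \<in> ?S. Re (fst p) < 1}" "openin (top_of_set ?S) {p \<in> ?S. Re (snd p) < 1}"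
    by (intro openin_Collect_less continuous_intros)+
  have closer_first_stick: "closer_first_stick = {p \<in> ?S. cmod (fst p - 1) < cmod (snd p - 1)} \<inter> {p \<in> ?S. 1 < cmod (snd p)}"
    by (auto simp: closer_first_stick_def closer_first_def)
  show "openin (top_of_set ?S) closer_first_stick"
    unfolding closer_first_stick using closer stick(2) by (rule openin_Int)
  have closer_first_circle: "closer_first_circle = {p \<in> ?S. cmod (fst p - 1) < cmod (snd p - 1)} \<inter> {p \<in> ?S. Re (snd p) < 1}"
    by (auto simp: closer_first_circle_def closer_first_def)
  show "openin (top_of_set ?S) closer_first_circle"
    unfolding closer_first_circle using closer circle(2) by (rule openin_Int)
  have stick_circle: "stick_circle = {p \<in> ?S. 1 < cmod (fst p)} \<inter> {p \<in> ?S. Re (snd p) < 1}"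
    by (auto simp: stick_circle_def)
  show "openin (top_of_set ?S) stick_circle"
    unfolding stick_circle using stick(1) circle(2) by (rule openin_Int)
  \<comment> \<open>\<open>Arg2pi\<close> is available as a continuous function only away from the
    junction, so the angle condition is shown to be open relative to \<open>C\<close> first.\<close>
  define C where "C = {p \<in> ?S. Re (fst p) < 1} \<inter> {p \<in> ?S. Re (snd p) < 1}"
  have C: "openin (top_of_set ?S) C"
    unfolding C_def using circle by (rule openin_Int)
  have CC: "fst p \<in> sphere 0 1 - {1}" "snd p \<in> sphere 0 1 - {1}" if "p \<in> C" for p
    using that planar_lollipop_circle_iff[of "fst p"] planar_lollipop_circle_iff[of "snd p"]
    by (auto simp: C_def planar_config_def)
  have "continuous_on C (\<lambda>p. Arg2pi (fst p))" "continuous_on C (\<lambda>p. Arg2pi (snd p))"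
    using CC by (auto intro!: continuous_on_compose2[OF continuous_on_Arg2pi_circle]
        continuous_on_fst continuous_on_snd continuous_on_id)
  then have "openin (top_of_set C) {p \<in> C. Arg2pi (fst p) < Arg2pi (snd p)}"
    by (rule openin_Collect_less)
  then have "openin (top_of_set ?S) {p \<in> C. Arg2pi (fst p) < Arg2pi (snd p)}"
    using C by (rule openin_trans)
  moreover have "circle_ordered = {p \<in> C. Arg2pi (fst p) < Arg2pi (snd p)}"
    by (auto simp: circle_ordered_def C_def)
  ultimately show "openin (top_of_set ?S) circle_ordered"
    by simp
qed

text \<open>Unequal distances to the junction lead to the \<open>closer_first\<close> pieces. With
  equal distances neither robot is at the junction, and they are not both on the stick, where the
  distance determines the point.\<close>

lemma planar_config_cases:
  assumes p: "p \<in> planar_config"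
  shows "p \<in> closer_first_stick \<or> p \<in> closer_first_circle \<or> p \<in> prod.swap ` closer_first_stick \<or>
    p \<in> prod.swap ` closer_first_circle \<or> p \<in> stick_circle \<or> p \<in> prod.swap ` stick_circle \<or>
    p \<in> circle_ordered \<or> p \<in> prod.swap ` circle_ordered"
proof -
  obtain x y where xy: "p = (x, y)" "x \<in> planar_lollipop" "y \<in> planar_lollipop" "x \<noteq> y"
    using p by (auto simp: planar_config_def)
  have part: "z = 1 \<or> Re z < 1 \<or> 1 < cmod z" if "z \<in> planar_lollipop" for z
    using that planar_lollipop_circle_iff[OF that] planar_lollipop_stick_iff[OF that]
    by (cases rule: planar_lollipop_cases) auto
  have swap: "p \<in> prod.swap ` A \<longleftrightarrow> (y, x) \<in> A" for A
    by (simp add: xy mem_swap_image_iff)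
  have conf: "(x, y) \<in> planar_config" "(y, x) \<in> planar_config"
    using xy by (auto simp: planar_config_def)
  show ?thesis
  proof (cases "cmod (x - 1) = cmod (y - 1)")
    case False
    then have "cmod (x - 1) < cmod (y - 1) \<and> y \<noteq> 1 \<or> cmod (y - 1) < cmod (x - 1) \<and> x \<noteq> 1"
      by (cases "x = 1"; cases "y = 1") auto
    then show ?thesis
      using conf part[OF xy(2)] part[OF xy(3)] unfolding swap
      by (auto simp: xy(1) closer_first_stick_def closer_first_circle_def closer_first_def)
  next
    case True
    then have "x \<noteq> 1" "y \<noteq> 1"
      using xy(4) by auto
    then consider "Re x < 1" "Re y < 1" | "Re x < 1" "1 < cmod y" | "1 < cmod x" "Re y < 1"
      | "1 < cmod x" "1 < cmod y"
      using part[OF xy(2)] part[OF xy(3)] by blast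
    then show ?thesis
    proof cases
      case 1
      then have "cis (Arg2pi x) = x" "cis (Arg2pi y) = y"
        using planar_lollipop_circle_iff[OF xy(2)] planar_lollipop_circle_iff[OF xy(3)]
        by (simp_all add: cis_Arg2pi_unit)
      then have "Arg2pi x \<noteq> Arg2pi y"
        using xy(4) by metis
      then show ?thesis
        using 1 conf unfolding swap by (auto simp: xy(1) circle_ordered_def)
    next
      case 4
      then obtain r s where "1 < r" "x = complex_of_real r" "1 < s" "y = complex_of_real s"
        using planar_lollipop_stick_iff[OF xy(2)] planar_lollipop_stick_iff[OF xy(3)] by auto
      moreover have "cmod (complex_of_real r - 1) = \<bar>r - 1\<bar>" for r
        using norm_of_real[of "r - 1", where 'a = complex] by simp
      ultimately show ?thesis
        using True xy(4) by simp
    qed (use conf in \<open>unfold swap, auto simp: xy(1) stick_circle_def\<close>)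
  qed
qed

section \<open>Path-connectedness\<close>

text \<open>Each of the eight pieces lies in one path component, so it suffices to link them through
  sample configurations that belong to two pieces at once.\<close>

lemma path_connected_planar_config: "path_connected planar_config"
proof -
  let ?R = "path_component planar_config"
  \<comment> \<open>Rational points of the circle on either side of the real axis, nearer to the
    junction than \<open>2\<close>, which in turn is nearer than \<open>-1\<close>.\<close>
  let ?z = "Complex (4/5) (3/5)" and ?z' = "Complex (4/5) (-3/5)"
  note null = nullhomotopic_closer_first_stick nullhomotopic_closer_first_circle
    nullhomotopic_stick_circle nullhomotopic_circle_ordered
  have z: "cmod ?z = 1" "cmod ?z' = 1" "cmod (?z - 1) < 1" "cmod (?z' - 1) < 1"
    by (simp_all add: cmod_def power2_eq_square)
  have zL: "?z \<in> planar_lollipop" "?z' \<in> planar_lollipop" "2 \<in> planar_lollipop" "- 1 \<in> planar_lollipop"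
    using z of_real_mem_planar_lollipop[of 2] by (auto simp: planar_lollipop_def)
  have arg: "Arg2pi ?z < Arg2pi (-1)" "Arg2pi (-1) < Arg2pi ?z'"
    using Arg2pi_lt_pi[of ?z] Arg2pi_le_pi[of ?z'] Arg2pi_of_real[of "-1"] by auto
  let ?b = "(?z, -1) :: complex \<times> complex"
  have A2: "(?z, -1) \<in> closer_first_circle" "(?z', -1) \<in> closer_first_circle"
    "(2, -1) \<in> closer_first_circle" and A1: "(?z, 2) \<in> closer_first_stick"
    using z zL by (auto simp: closer_first_stick_def closer_first_circle_def closer_first_def planar_config_def complex_eq_iff)
  have E: "(2, -1) \<in> stick_circle" "(2, ?z) \<in> stick_circle"
    using z zL by (auto simp: stick_circle_def planar_config_def complex_eq_iff)
  have C: "(?z, -1) \<in> circle_ordered" "(-1, ?z') \<in> circle_ordered"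
    using z zL arg by (auto simp: circle_ordered_def planar_config_def complex_eq_iff)
  have sw: "(b, a) \<in> prod.swap ` P" if "(a, b) \<in> P" for a b :: complex and P
    using that by (simp add: mem_swap_image_iff)
  have step: "?R p ?b" if "nullhomotopic_in planar_config P" "q \<in> P" "?R q ?b" "p \<in> P" for p q P
    using nullhomotopic_in_path_component[OF that(1,4,2)] that(3) by (rule path_component_trans)
  have b: "?R ?b ?b"
    using A2(1) by (intro nullhomotopic_in_path_component[OF null(2)])
  \<comment> \<open>\<open>A1\<close>, \<open>A2\<close>, \<open>E\<close>, \<open>C\<close> stand
    for the pieces and \<open>B1\<close>, \<open>B2\<close>, \<open>F\<close>, \<open>D\<close> for
    their swaps. \<open>A2\<close> and \<open>C\<close> contain the base configuration; every other
    piece shares a sample configuration with one handled earlier. For example,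
    \<open>(-1, ?z')\<close> leads from \<open>circle_ordered\<close> to the swap of
    \<open>closer_first_circle\<close>.\<close>
  note step_A2 = step[OF null(2) A2(1) b]
  note step_C = step[OF null(4) C(1) b]
  note step_E = step[OF null(3) E(1) step_A2[OF A2(3)]]
  note step_B1 = step[OF null(1)[THEN nullhomotopic_in_swap] sw[OF A1] step_E[OF E(2)]]
  note step_B2 = step[OF null(2)[THEN nullhomotopic_in_swap] sw[OF A2(2)] step_C[OF C(2)]]
  note step_D = step[OF null(4)[THEN nullhomotopic_in_swap] sw[OF C(1)] step_B2[OF sw[OF A2(1)]]]
  note step_F = step[OF null(3)[THEN nullhomotopic_in_swap] sw[OF E(1)] step_B2[OF sw[OF A2(3)]]]
  note step_A1 = step[OF null(1) A1 step_F[OF sw[OF E(2)]]]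
  have "?R p ?b" if "p \<in> planar_config" for p
    using planar_config_cases[OF that]
    by (elim disjE) (fact step_A1 step_A2 step_B1 step_B2 step_E step_F step_C step_D)+
  then show ?thesis
    unfolding path_connected_component using path_component_sym path_component_trans by meson
qed

section \<open>Combining the two bounds\<close>

lemma topological_complexity_planar_config:
  "topological_complexity (top_of_set planar_config) = 3"
proof (rule antisym)
  let ?O = "\<Union>{closer_first_stick, closer_first_circle, prod.swap ` closer_first_stick, prod.swap ` closer_first_circle}"
  let ?E = "\<Union>{stick_circle, prod.swap ` stick_circle, circle_ordered, prod.swap ` circle_ordered}"
  note defs = closer_first_stick_def closer_first_circle_def closer_first_def stick_circle_def circle_ordered_def
  note null = nullhomotopic_closer_first_stick nullhomotopic_closer_first_circle
    nullhomotopic_stick_circle nullhomotopic_circle_ordered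
  have excl: "\<not> Re z < 1" if "1 < cmod z" "z \<in> planar_lollipop" for z
    using planar_lollipop_circle_iff[OF that(2)] that(1) by auto
  show "topological_complexity (top_of_set planar_config) \<le> 3"
  proof (rule topological_complexity_le_3[OF path_connected_planar_config])
    show "openin (top_of_set planar_config) ?O" "openin (top_of_set planar_config) ?E"
      using openin_pieces openin_pieces[THEN openin_planar_config_swap] by (auto intro!: openin_Union)
    \<comment> \<open>The order of the distances separates a piece from the swapped ones;
      \<open>excl\<close> separates stick from circle for the farther robot.\<close>
    have "pairwise disjnt {closer_first_stick, closer_first_circle, prod.swap ` closer_first_stick, prod.swap ` closer_first_circle}"
      using excl by (auto simp: pairwise_insert disjnt_iff defs planar_config_def)
    then show "nullhomotopic_in planar_config ?O"
      using openin_pieces openin_pieces[THEN openin_planar_config_swap] null null[THEN nullhomotopic_in_swap]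
      by (intro nullhomotopic_in_Union path_connected_planar_config) auto
    have "pairwise disjnt {stick_circle, prod.swap ` stick_circle, circle_ordered, prod.swap ` circle_ordered}"
      using excl by (auto simp: pairwise_insert disjnt_iff defs planar_config_def)
    then show "nullhomotopic_in planar_config ?E"
      using openin_pieces openin_pieces[THEN openin_planar_config_swap] null null[THEN nullhomotopic_in_swap]
      by (intro nullhomotopic_in_Union path_connected_planar_config) auto
    have "(y, x) \<in> planar_config" if "(x, y) \<in> planar_config" for x y
      using that by (auto simp: planar_config_def)
    then have "?O \<subseteq> planar_config" "?E \<subseteq> planar_config"
      by (auto simp: defs)
    moreover have "p \<in> ?O \<union> ?E" if "p \<in> planar_config" for p
      using planar_config_cases[OF that] by (elim disjE) (simp_all only: Union_insert Un_iff simp_thms)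
    ultimately show "?O \<union> ?E = planar_config"
      by (meson Un_least subsetI subset_antisym)
  qed
  show "3 \<le> topological_complexity (top_of_set planar_config)"
    unfolding planar_config_def by (rule topological_complexity_config_ge)
      (auto simp: planar_lollipop_def image_iff intro!: bexI[of _ 2])
qed

theorem theorem6p3:
  shows "topological_complexity (config2 lollipop) = 3"
proof -
  have "config2 lollipop homeomorphic_space top_of_set planar_config"
    using config2_homeomorphic_space[OF lollipop_homeomorphic_planar]
    by (simp add: config2_top_of_set planar_config_def)
  then show ?thesis
    using topological_complexity_homeomorphic topological_complexity_planar_config by metis
qed

end
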